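(* Let $R$ be a rig in $\mathscr V$. Then $\mathrm{Mat}_R$ is saturated with respect to $R$ and hence is a saturated subtheory of the full theory $\underline{\mathscr V}_R$ of $R$ in $\underline{\mathscr V}$. Further, if $R$ is commutative, then the subtheory $\mathrm{Mat}_R\hookrightarrow\underline{\mathscr V}_R$ is balanced, and $\mathrm{Mat}_R$ is commutative.
   Context: $\mathscr V$ is a locally small cartesian closed category with equalizers, countable colimits, and intersections of countable families of strong subobjects; $\underline{\mathscr V}$ is $\mathscr V$ as a $\mathscr V$-category, with internal homs $\underline{\mathscr V}(V,W)$. Algebraic formulas below are to be read for generalized elements. \emph{Theories.} A theory (discretely finitary, enriched in $\mathscr V$) is a $\mathscr V$-category $\mathscr T$ whose objects are the natural numbers, equipped for each $n$ with morphisms $\pi_i:n\to1$ ($1\le i\le n$) exhibiting $n$ as a conical ($\mathscr V$-enriched) $n$-th power of $1$, with $\pi_1=\mathrm{id}$ if $n=1$. Morphisms of theories are identity-on-objects $\mathscr V$-functors preserving the designated $\pi_i$; $\mathrm{Th}$ is the resulting category. A subtheory of $\mathscr U$ is a theory $\mathscr T$ with a morphism $\mathscr T\to\mathscr U$ whose structure morphisms $\mathscr T(n,m)\to\mathscr U(n,m)$ are monomorphisms. A $\mathscr T$-algebra is a $\mathscr V$-functor $A:\mathscr T\to\underline{\mathscr V}$ preserving conical finite powers, with carrier $|A|=A(1)$. $\mathscr T\text{-Alg}$ is the $\mathscr V$-category of $\mathscr T$-algebras, with hom-objects the objects of $\mathscr V$-natural transformations; limits in it are pointwise. A theory $\mathscr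 T$ is commutative if its corresponding $\mathscr V$-monad on $\underline{\mathscr V}$ is commutative in Kock's sense; equivalently, for all $n,m$ the two morphisms $\mathscr T(n,1)\times\mathscr T(m,1)\to\mathscr T(nm,1)$ given by $(\mu,\nu)\mapsto\mu\circ\nu^n$ and $(\mu,\nu)\mapsto\nu\circ\mu^m$ (identifying both $m^n$ and $n^m$ with the $(n\times m)$-th power of $1$) are equal. \emph{Commutants.} For $X\in\mathscr V$, the full theory $\underline{\mathscr V}_X$ has $\underline{\mathscr V}_X(n,m)=\underline{\mathscr V}(X^n,X^m)$, composition as in $\underline{\mathscr V}$, and the product projections as designated $\pi_i$. A theory over $\underline{\mathscr V}_X$ is a theory $\mathscr T$ with a morphism $A:\mathscr T\to\underline{\mathscr V}_X$; it amounts to a $\mathscr T$-algebra $n\mapsto X^n$ with carrier $X$, also called $A$. Its commutant $\mathscr T^\perp$ is the theory with $\mathscr T^\perp(n,m)=\mathscr T\text{-Alg}(A^n,A^m)$ (powers of $A$ in $\mathscr T\text{-Alg}$), with composition as in $\mathscr T\text{-Alg}$; the forgetful morphisms $\mathscr T\text{-Alg}(A^n,A^m)\hookrightarrow\underline{\mathscr V}(X^n,X^m)$ make $\mathscr T^\perp$ a theory over $\underline{\mathscr V}_X$. A theory $\mathscr T$ over $\underline{\mathscr V}_X$ (equivalently, a theory with respect to a given $\mathscr T$-algebra with carrier $X$) is saturated if $\mathscr T^{\perp\perp}\cong\mathscr T$, and balanced if $\mathscr T^\perp\cong\mathscr T$, in the slice category $\mathrm{Th}/\underline{\mathscr V}_X$.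 \emph{Rigs and matrices.} A rig in $\mathscr V$ is an object $R$ with a commutative monoid structure $(+,0)$ and a monoid structure $(\bullet,1)$ in $\mathscr V$ such that $\bullet$ preserves $+$ and $0$ in each variable separately; it is commutative if $\bullet$ is. $\mathrm{Mat}_R$ is the theory (of left $R$-modules) with $\mathrm{Mat}_R(n,m)=R^{m\times n}$, composition given by matrix multiplication $(b,a)\mapsto ba$, $(ba)_{ki}=\sum_jb_{kj}a_{ji}$, identities the identity matrices, and designated projections $\pi_i:n\to1$ the standard basis row vectors. Its normal algebras are the left $R$-modules. The left $R$-module $R$ makes $\mathrm{Mat}_R$ a theory over $\underline{\mathscr V}_R$, via $a\in R^{m\times n}\mapsto\big(x\mapsto(\sum_ia_{ji}x_i)_j\big)$. *)

theory Defs
  imports Main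
begin

section \<open>Categories\<close>

record ('o, 'm) category =
  Obj :: "'o set"
  Arr :: "'m set"
  Src :: "'m \<Rightarrow> 'o"
  Tgt :: "'m \<Rightarrow> 'o"
  Ide :: "'o \<Rightarrow> 'm"
  Comp :: "'m \<Rightarrow> 'm \<Rightarrow> 'm"  (infixl "\<cdot>\<index>" 70)

definition hom :: "('o, 'm, 'x) category_scheme \<Rightarrow> 'o \<Rightarrow> 'o \<Rightarrow> 'm set" where
  "hom C a b = {f \<in> Arr C. Src C f = a \<and> Tgt C f = b}"

locale category =
  fixes C :: "('o, 'm, 'x) category_scheme" (structure)
  assumes src_obj: "f \<in> Arr C \<Longrightarrow> Src C f \<in> Obj C"
    and tgt_obj: "f \<in> Arr C \<Longrightarrow> Tgt C f \<in> Obj C"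
    and ide_hom: "a \<in> Obj C \<Longrightarrow> Ide C a \<in> hom C a a"
    and comp_hom: "\<lbrakk>f \<in> hom C a b; g \<in> hom C b c\<rbrakk> \<Longrightarrow> g \<cdot> f \<in> hom C a c"
    and comp_assoc: "\<lbrakk>f \<in> hom C a b; g \<in> hom C b c; h \<in> hom C c d\<rbrakk>
           \<Longrightarrow> h \<cdot> (g \<cdot> f) = (h \<cdot> g) \<cdot> f"
    and ide_left: "f \<in> hom C a b \<Longrightarrow> Ide C b \<cdot> f = f"
    and ide_right: "f \<in> hom C a b \<Longrightarrow> f \<cdot> Ide C a = f"

context
  fixes C :: "('o, 'm, 'x) category_scheme" (structure)
begin

definition is_iso :: "'m \<Rightarrow> bool" where
  "is_iso f \<longleftrightarrow> f \<in> Arr C \<and>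
     (\<exists>g \<in> hom C (Tgt C f) (Src C f). g \<cdot> f = Ide C (Src C f) \<and> f \<cdot> g = Ide C (Tgt C f))"

definition is_mono :: "'m \<Rightarrow> bool" where
  "is_mono m \<longleftrightarrow> m \<in> Arr C \<and>
     (\<forall>z. \<forall>f \<in> hom C z (Src C m). \<forall>g \<in> hom C z (Src C m). m \<cdot> f = m \<cdot> g \<longrightarrow> f = g)"

definition is_epi :: "'m \<Rightarrow> bool" where
  "is_epi e \<longleftrightarrow> e \<in> Arr C \<and>
     (\<forall>z. \<forall>f \<in> hom C (Tgt C e) z. \<forall>g \<in> hom C (Tgt C e) z. f \<cdot> e = g \<cdot> e \<longrightarrow> f = g)"

definition is_strong_mono :: "'m \<Rightarrow> bool" where
  "is_strong_mono m \<longleftrightarrow> is_mono m \<and>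
     (\<forall>e u v. is_epi e \<and> u \<in> hom C (Src C e) (Src C m) \<and> v \<in> hom C (Tgt C e) (Tgt C m)
        \<and> m \<cdot> u = v \<cdot> e
        \<longrightarrow> (\<exists>d \<in> hom C (Tgt C e) (Src C m). d \<cdot> e = u \<and> m \<cdot> d = v))"

definition has_equalizers :: bool where
  "has_equalizers \<longleftrightarrow> (\<forall>a b. \<forall>f \<in> hom C a b. \<forall>g \<in> hom C a b.
     \<exists>e. e \<in> Arr C \<and> Tgt C e = a \<and> f \<cdot> e = g \<cdot> e \<and>
       (\<forall>z. \<forall>h \<in> hom C z a. f \<cdot> h = g \<cdot> h \<longrightarrow> (\<exists>!k. k \<in> hom C z (Src C e) \<and> e \<cdot> k = h)))"

definition is_diagram :: "('i, 'u) category \<Rightarrow> ('i \<Rightarrow> 'o) \<Rightarrow> ('u \<Rightarrow> 'm) \<Rightarrow> bool" where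
  "is_diagram J Do Da \<longleftrightarrow>
     (\<forall>i \<in> Obj J. Do i \<in> Obj C \<and> Da (Ide J i) = Ide C (Do i)) \<and>
     (\<forall>i j. \<forall>u \<in> hom J i j. Da u \<in> hom C (Do i) (Do j)) \<and>
     (\<forall>i j k. \<forall>u \<in> hom J i j. \<forall>v \<in> hom J j k. Da (v \<cdot>\<^bsub>J\<^esub> u) = Da v \<cdot> Da u)"

definition is_cocone ::
    "('i, 'u) category \<Rightarrow> ('i \<Rightarrow> 'o) \<Rightarrow> ('u \<Rightarrow> 'm) \<Rightarrow> 'o \<Rightarrow> ('i \<Rightarrow> 'm) \<Rightarrow> bool" where
  "is_cocone J Do Da c q \<longleftrightarrow> c \<in> Obj C \<and> (\<forall>i \<in> Obj J. q i \<in> hom C (Do i) c) \<and>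
     (\<forall>i j. \<forall>u \<in> hom J i j. q j \<cdot> Da u = q i)"

definition is_colimit ::
    "('i, 'u) category \<Rightarrow> ('i \<Rightarrow> 'o) \<Rightarrow> ('u \<Rightarrow> 'm) \<Rightarrow> 'o \<Rightarrow> ('i \<Rightarrow> 'm) \<Rightarrow> bool" where
  "is_colimit J Do Da c q \<longleftrightarrow> is_cocone J Do Da c q \<and>
     (\<forall>c' q'. is_cocone J Do Da c' q' \<longrightarrow>
        (\<exists>!h. h \<in> hom C c c' \<and> (\<forall>i \<in> Obj J. h \<cdot> q i = q' i)))"

text \<open>Every category with countably many objects and arrows is isomorphic to one whose objects
  and arrows are natural numbers.\<close>

definition has_countable_colimits :: bool where
  "has_countable_colimits \<longleftrightarrow> (\<forall>(J :: (nat, nat) category) Do Da.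
     category J \<and> is_diagram J Do Da \<longrightarrow> (\<exists>c q. is_colimit J Do Da c q))"

text \<open>A finite non-empty family can be repeated to a sequence, and the empty family of subobjects
  of an object has the identity as its intersection; so sequences suffice.\<close>

definition has_countable_strong_intersections :: bool where
  "has_countable_strong_intersections \<longleftrightarrow> (\<forall>x (m :: nat \<Rightarrow> 'm).
     (\<forall>i. is_strong_mono (m i) \<and> Tgt C (m i) = x) \<longrightarrow>
     (\<exists>s. is_mono s \<and> Tgt C s = x \<and>
        (\<forall>i. \<exists>k \<in> hom C (Src C s) (Src C (m i)). m i \<cdot> k = s) \<and>
        (\<forall>z. \<forall>f \<in> hom C z x. (\<forall>i. \<exists>k \<in> hom C z (Src C (m i)). m i \<cdot> k = f) \<longrightarrow>
           (\<exists>k \<in> hom C z (Src C s). s \<cdot> k = f))))"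

end


section \<open>Cartesian closed categories\<close>

text \<open>A cartesian closed category is given with a choice of terminal object, binary products,
  exponentials (\<open>Exp V a b\<close> is the internal hom from \<open>a\<close> to \<open>b\<close>) and finite powers, the first power
  of an object being that object. In \<open>Pr V x n i\<close> the index \<open>i < n\<close> counts from zero.\<close>

record ('o, 'm) ccc = "('o, 'm) category" +
  One :: "'o"
  Prod :: "'o \<Rightarrow> 'o \<Rightarrow> 'o"  (infixr "\<otimes>\<index>" 75)
  Fst :: "'o \<Rightarrow> 'o \<Rightarrow> 'm"
  Snd :: "'o \<Rightarrow> 'o \<Rightarrow> 'm"
  Exp :: "'o \<Rightarrow> 'o \<Rightarrow> 'o"
  Ev :: "'o \<Rightarrow> 'o \<Rightarrow> 'm"
  Pw :: "'o \<Rightarrow> nat \<Rightarrow> 'o"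
  Pr :: "'o \<Rightarrow> nat \<Rightarrow> nat \<Rightarrow> 'm"

definition pair :: "('o, 'm, 'x) ccc_scheme \<Rightarrow> 'm \<Rightarrow> 'm \<Rightarrow> 'm"  ("\<langle>_,/ _\<rangle>\<index>") where
  "pair V f g = (THE h. h \<in> hom V (Src V f) (Prod V (Tgt V f) (Tgt V g)) \<and>
     Fst V (Tgt V f) (Tgt V g) \<cdot>\<^bsub>V\<^esub> h = f \<and> Snd V (Tgt V f) (Tgt V g) \<cdot>\<^bsub>V\<^esub> h = g)"

locale cartesian_closed = category V
  for V :: "('o, 'm, 'x) ccc_scheme" (structure) +
  assumes one_obj: "One V \<in> Obj V"
    and one_univ: "a \<in> Obj V \<Longrightarrow> \<exists>!f. f \<in> hom V a (One V)"
    and prod_obj: "\<lbrakk>a \<in> Obj V; b \<in> Obj V\<rbrakk> \<Longrightarrow> a \<otimes> b \<in> Obj V"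
    and fst_hom: "\<lbrakk>a \<in> Obj V; b \<in> Obj V\<rbrakk> \<Longrightarrow> Fst V a b \<in> hom V (a \<otimes> b) a"
    and snd_hom: "\<lbrakk>a \<in> Obj V; b \<in> Obj V\<rbrakk> \<Longrightarrow> Snd V a b \<in> hom V (a \<otimes> b) b"
    and prod_univ: "\<lbrakk>f \<in> hom V z a; g \<in> hom V z b\<rbrakk>
          \<Longrightarrow> \<exists>!h. h \<in> hom V z (a \<otimes> b) \<and> Fst V a b \<cdot> h = f \<and> Snd V a b \<cdot> h = g"
    and exp_obj: "\<lbrakk>a \<in> Obj V; b \<in> Obj V\<rbrakk> \<Longrightarrow> Exp V a b \<in> Obj V"
    and ev_hom: "\<lbrakk>a \<in> Obj V; b \<in> Obj V\<rbrakk> \<Longrightarrow> Ev V a b \<in> hom V (Exp V a b \<otimes> a) b"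
    and exp_univ: "\<lbrakk>z \<in> Obj V; a \<in> Obj V; f \<in> hom V (z \<otimes> a) b\<rbrakk>
          \<Longrightarrow> \<exists>!h. h \<in> hom V z (Exp V a b) \<and> Ev V a b \<cdot> \<langle>h \<cdot> Fst V z a, Snd V z a\<rangle> = f"
    and pw_obj: "x \<in> Obj V \<Longrightarrow> Pw V x n \<in> Obj V"
    and pr_hom: "\<lbrakk>x \<in> Obj V; i < n\<rbrakk> \<Longrightarrow> Pr V x n i \<in> hom V (Pw V x n) x"
    and pw_univ: "\<lbrakk>z \<in> Obj V; x \<in> Obj V; \<And>i. i < n \<Longrightarrow> fs i \<in> hom V z x\<rbrakk>
          \<Longrightarrow> \<exists>!h. h \<in> hom V z (Pw V x n) \<and> (\<forall>i<n. Pr V x n i \<cdot> h = fs i)"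
    and pw_1: "x \<in> Obj V \<Longrightarrow> Pw V x 1 = x"
    and pr_1: "x \<in> Obj V \<Longrightarrow> Pr V x 1 0 = Ide V x"

context
  fixes V :: "('o, 'm) ccc" (structure)
begin

definition bang :: "'o \<Rightarrow> 'm" where
  "bang a = (THE f. f \<in> hom V a (One V))"

text \<open>A global element regarded as a constant generalized element at stage \<open>z\<close>.\<close>

definition const :: "'o \<Rightarrow> 'm \<Rightarrow> 'm" where
  "const z e = e \<cdot> bang z"

definition tuple :: "'o \<Rightarrow> 'o \<Rightarrow> nat \<Rightarrow> (nat \<Rightarrow> 'm) \<Rightarrow> 'm" where
  "tuple z x n f = (THE h. h \<in> hom V z (Pw V x n) \<and> (\<forall>i<n. Pr V x n i \<cdot> h = f i))"

definition curry :: "'o \<Rightarrow> 'o \<Rightarrow> 'm \<Rightarrow> 'm" where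
  "curry z a f = (THE h. h \<in> hom V z (Exp V a (Tgt V f)) \<and>
     Ev V a (Tgt V f) \<cdot> \<langle>h \<cdot> Fst V z a, Snd V z a\<rangle> = f)"

text \<open>The global element of an internal hom that corresponds to an arrow.\<close>

definition name_of :: "'m \<Rightarrow> 'm" where
  "name_of f = curry (One V) (Src V f) (f \<cdot> Snd V (One V) (Src V f))"

end


section \<open>Enriched categories\<close>

text \<open>\<open>VComp C a b c\<close> is the composition morphism from \<open>VHom C b c \<otimes> VHom C a b\<close> to \<open>VHom C a c\<close>.\<close>

record ('a, 'o, 'm) vcat =
  VObj :: "'a set"
  VHom :: "'a \<Rightarrow> 'a \<Rightarrow> 'o"
  VId :: "'a \<Rightarrow> 'm"
  VComp :: "'a \<Rightarrow> 'a \<Rightarrow> 'a \<Rightarrow> 'm"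

context
  fixes V :: "('o, 'm) ccc" (structure)
begin

text \<open>Composition of generalized elements of the hom-objects. The axioms of enriched category
  theory are stated for generalized elements at an arbitrary stage \<open>z\<close>; by the Yoneda lemma this is
  the same as the commutativity of the usual diagrams.\<close>

definition vcomp :: "('a, 'o, 'm, 'x) vcat_scheme \<Rightarrow> 'a \<Rightarrow> 'a \<Rightarrow> 'a \<Rightarrow> 'm \<Rightarrow> 'm \<Rightarrow> 'm" where
  "vcomp C a b c g f = VComp C a b c \<cdot> \<langle>g, f\<rangle>"

definition is_vcategory :: "('a, 'o, 'm, 'x) vcat_scheme \<Rightarrow> bool" where
  "is_vcategory C \<longleftrightarrow>
     (\<forall>a \<in> VObj C. \<forall>b \<in> VObj C. VHom C a b \<in> Obj V) \<and>
     (\<forall>a \<in> VObj C. VId C a \<in> hom V (One V) (VHom C a a)) \<and>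
     (\<forall>a \<in> VObj C. \<forall>b \<in> VObj C. \<forall>c \<in> VObj C.
        VComp C a b c \<in> hom V (VHom C b c \<otimes> VHom C a b) (VHom C a c)) \<and>
     (\<forall>a \<in> VObj C. \<forall>b \<in> VObj C. \<forall>z \<in> Obj V. \<forall>f \<in> hom V z (VHom C a b).
        vcomp C a b b (const V z (VId C b)) f = f \<and>
        vcomp C a a b f (const V z (VId C a)) = f) \<and>
     (\<forall>a \<in> VObj C. \<forall>b \<in> VObj C. \<forall>c \<in> VObj C. \<forall>d \<in> VObj C. \<forall>z \<in> Obj V.
        \<forall>f \<in> hom V z (VHom C a b). \<forall>g \<in> hom V z (VHom C b c). \<forall>h \<in> hom V z (VHom C c d).
        vcomp C a c d h (vcomp C a b c g f) = vcomp C a b d (vcomp C b c d h g) f)"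

definition self_vcat :: "('o, 'o, 'm) vcat" where
  "self_vcat = \<lparr>
     VObj = Obj V,
     VHom = Exp V,
     VId = (\<lambda>a. name_of V (Ide V a)),
     VComp = (\<lambda>a b c. let z = Exp V b c \<otimes> Exp V a b in
        curry V z a
          (Ev V b c \<cdot> \<langle>Fst V (Exp V b c) (Exp V a b) \<cdot> Fst V z a,
             Ev V a b \<cdot> \<langle>Snd V (Exp V b c) (Exp V a b) \<cdot> Fst V z a, Snd V z a\<rangle>\<rangle>)) \<rparr>"

definition is_vfunctor ::
    "('a, 'o, 'm, 'x) vcat_scheme \<Rightarrow> ('b, 'o, 'm, 'y) vcat_scheme \<Rightarrow>
     ('a \<Rightarrow> 'b) \<Rightarrow> ('a \<Rightarrow> 'a \<Rightarrow> 'm) \<Rightarrow> bool" where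
  "is_vfunctor C D Fo Fm \<longleftrightarrow> is_vcategory C \<and> is_vcategory D \<and>
     (\<forall>a \<in> VObj C. Fo a \<in> VObj D) \<and>
     (\<forall>a \<in> VObj C. \<forall>b \<in> VObj C. Fm a b \<in> hom V (VHom C a b) (VHom D (Fo a) (Fo b))) \<and>
     (\<forall>a \<in> VObj C. Fm a a \<cdot> VId C a = VId D (Fo a)) \<and>
     (\<forall>a \<in> VObj C. \<forall>b \<in> VObj C. \<forall>c \<in> VObj C. \<forall>z \<in> Obj V.
        \<forall>f \<in> hom V z (VHom C a b). \<forall>g \<in> hom V z (VHom C b c).
        Fm a c \<cdot> vcomp C a b c g f
          = vcomp D (Fo a) (Fo b) (Fo c) (Fm b c \<cdot> g) (Fm a b \<cdot> f))"

text \<open>Families from \<open>z\<close> that are natural between functors into \<open>self_vcat\<close>, and the object of natural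
  transformations (the end of the internal homs) with its evaluation morphisms \<open>p\<close>.\<close>

definition is_natural_family ::
    "('a, 'o, 'm, 'x) vcat_scheme \<Rightarrow> ('a \<Rightarrow> 'o) \<Rightarrow> ('a \<Rightarrow> 'a \<Rightarrow> 'm) \<Rightarrow>
     ('a \<Rightarrow> 'o) \<Rightarrow> ('a \<Rightarrow> 'a \<Rightarrow> 'm) \<Rightarrow> 'o \<Rightarrow> ('a \<Rightarrow> 'm) \<Rightarrow> bool" where
  "is_natural_family C Fo Fm Go Gm z p \<longleftrightarrow> z \<in> Obj V \<and>
     (\<forall>a \<in> VObj C. p a \<in> hom V z (Exp V (Fo a) (Go a))) \<and>
     (\<forall>a \<in> VObj C. \<forall>b \<in> VObj C. \<forall>w. \<forall>s \<in> hom V w z. \<forall>t \<in> hom V w (VHom C a b).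
        vcomp self_vcat (Fo a) (Fo b) (Go b) (p b \<cdot> s) (Fm a b \<cdot> t)
          = vcomp self_vcat (Fo a) (Go a) (Go b) (Gm a b \<cdot> t) (p a \<cdot> s))"

definition is_nat_object ::
    "('a, 'o, 'm, 'x) vcat_scheme \<Rightarrow> ('a \<Rightarrow> 'o) \<Rightarrow> ('a \<Rightarrow> 'a \<Rightarrow> 'm) \<Rightarrow>
     ('a \<Rightarrow> 'o) \<Rightarrow> ('a \<Rightarrow> 'a \<Rightarrow> 'm) \<Rightarrow> 'o \<Rightarrow> ('a \<Rightarrow> 'm) \<Rightarrow> bool" where
  "is_nat_object C Fo Fm Go Gm N p \<longleftrightarrow> is_natural_family C Fo Fm Go Gm N p \<and>
     (\<forall>z q. is_natural_family C Fo Fm Go Gm z q \<longrightarrow>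
        (\<exists>!h. h \<in> hom V z N \<and> (\<forall>a \<in> VObj C. p a \<cdot> h = q a)))"

definition exhibits_power ::
    "('a, 'o, 'm, 'x) vcat_scheme \<Rightarrow> 'a \<Rightarrow> 'a \<Rightarrow> nat \<Rightarrow> (nat \<Rightarrow> 'm) \<Rightarrow> bool" where
  "exhibits_power C c x n p \<longleftrightarrow> c \<in> VObj C \<and> x \<in> VObj C \<and>
     (\<forall>i<n. p i \<in> hom V (One V) (VHom C c x)) \<and>
     (\<forall>d \<in> VObj C. is_iso V
        (tuple V (VHom C d c) (VHom C d x) n
          (\<lambda>i. vcomp C d c x (const V (VHom C d c) (p i)) (Ide V (VHom C d c)))))"

end


section \<open>Theories\<close>

record ('o, 'm) thy = "(nat, 'o, 'm) vcat" +
  Proj :: "nat \<Rightarrow> nat \<Rightarrow> 'm"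

context
  fixes V :: "('o, 'm) ccc" (structure)
begin

definition is_theory :: "('o, 'm) thy \<Rightarrow> bool" where
  "is_theory T \<longleftrightarrow> is_vcategory V T \<and> VObj T = UNIV \<and>
     (\<forall>n. exhibits_power V T n 1 n (Proj T n)) \<and> Proj T 1 0 = VId T 1"

definition is_theory_morphism ::
    "('o, 'm) thy \<Rightarrow> ('o, 'm) thy \<Rightarrow> (nat \<Rightarrow> nat \<Rightarrow> 'm) \<Rightarrow> bool" where
  "is_theory_morphism T U F \<longleftrightarrow> is_theory T \<and> is_theory U \<and> is_vfunctor V T U id F \<and>
     (\<forall>n. \<forall>i<n. F n 1 \<cdot> Proj T n i = Proj U n i)"

definition is_subtheory ::
    "('o, 'm) thy \<Rightarrow> ('o, 'm) thy \<Rightarrow> (nat \<Rightarrow> nat \<Rightarrow> 'm) \<Rightarrow> bool" where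
  "is_subtheory T U F \<longleftrightarrow> is_theory_morphism T U F \<and> (\<forall>n m. is_mono V (F n m))"

text \<open>Tuples of generalized elements of a theory, with respect to its designated projections.\<close>

definition thy_tuple :: "('o, 'm) thy \<Rightarrow> 'o \<Rightarrow> nat \<Rightarrow> nat \<Rightarrow> (nat \<Rightarrow> 'm) \<Rightarrow> 'm" where
  "thy_tuple T z k n f = (THE h. h \<in> hom V z (VHom T k n) \<and>
     (\<forall>i<n. vcomp V T k n 1 (const V z (Proj T n i)) h = f i))"

text \<open>Commutativity of the corresponding monad in the sense of Kock, expressed within the theory as
  the equality of \<open>\<mu> \<circ> \<nu>\<^sup>n\<close> and \<open>\<nu> \<circ> \<mu>\<^sup>m\<close> for \<open>\<mu>\<close> of arity \<open>n\<close> and \<open>\<nu>\<close> of arity \<open>m\<close>. The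
  projection of the object \<open>n * m\<close> with index \<open>i * m + j\<close> is the one labelled by
  \<open>(i, j)\<close>; thus \<open>row i\<close> and \<open>col j\<close> are the morphisms onto the \<open>i\<close>-th copy of \<open>m\<close> and the
  \<open>j\<close>-th copy of \<open>n\<close>.\<close>

definition is_commutative_theory :: "('o, 'm) thy \<Rightarrow> bool" where
  "is_commutative_theory T \<longleftrightarrow> is_theory T \<and> (\<forall>n m.
     let z = VHom T n 1 \<otimes> VHom T m 1;
         \<mu> = Fst V (VHom T n 1) (VHom T m 1);
         \<nu> = Snd V (VHom T n 1) (VHom T m 1);
         row = (\<lambda>i. thy_tuple T z (n * m) m (\<lambda>j. const V z (Proj T (n * m) (i * m + j))));
         col = (\<lambda>j. thy_tuple T z (n * m) n (\<lambda>i. const V z (Proj T (n * m) (i * m + j))));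
         \<nu>n = thy_tuple T z (n * m) n (\<lambda>i. vcomp V T (n * m) m 1 \<nu> (row i));
         \<mu>m = thy_tuple T z (n * m) m (\<lambda>j. vcomp V T (n * m) n 1 \<mu> (col j))
     in vcomp V T (n * m) n 1 \<mu> \<nu>n = vcomp V T (n * m) m 1 \<nu> \<mu>m)"

definition full_theory :: "'o \<Rightarrow> ('o, 'm) thy" where
  "full_theory X = \<lparr>
     VObj = UNIV,
     VHom = (\<lambda>n m. VHom (self_vcat V) (Pw V X n) (Pw V X m)),
     VId = (\<lambda>n. VId (self_vcat V) (Pw V X n)),
     VComp = (\<lambda>n m k. VComp (self_vcat V) (Pw V X n) (Pw V X m) (Pw V X k)),
     Proj = (\<lambda>n i. name_of V (Pr V X n i)) \<rparr>"

definition is_theory_over :: "'o \<Rightarrow> ('o, 'm) thy \<Rightarrow> (nat \<Rightarrow> nat \<Rightarrow> 'm) \<Rightarrow> bool" where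
  "is_theory_over X T A \<longleftrightarrow> X \<in> Obj V \<and> is_theory_morphism T (full_theory X) A"

text \<open>Isomorphism in the slice category of theories over \<open>full_theory X\<close>.\<close>

definition iso_over ::
    "'o \<Rightarrow> ('o, 'm) thy \<Rightarrow> (nat \<Rightarrow> nat \<Rightarrow> 'm) \<Rightarrow> ('o, 'm) thy \<Rightarrow> (nat \<Rightarrow> nat \<Rightarrow> 'm) \<Rightarrow> bool" where
  "iso_over X S B T A \<longleftrightarrow> is_theory_over X S B \<and> is_theory_over X T A \<and>
     (\<exists>F G. is_theory_morphism S T F \<and> is_theory_morphism T S G \<and>
        (\<forall>n m. A n m \<cdot> F n m = B n m \<and> B n m \<cdot> G n m = A n m \<and>
           G n m \<cdot> F n m = Ide V (VHom S n m) \<and> F n m \<cdot> G n m = Ide V (VHom T n m)))"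


section \<open>Commutants\<close>

text \<open>A theory \<open>A\<close> over \<open>full_theory X\<close> is regarded as the algebra \<open>k \<mapsto> Pw V X k\<close>. Its
  \<open>n\<close>-th power is formed pointwise: it is the functor \<open>k \<mapsto> Pw V (Pw V X k) n\<close> with the
  following action on hom-objects.\<close>

definition alg_pw ::
    "'o \<Rightarrow> ('o, 'm) thy \<Rightarrow> (nat \<Rightarrow> nat \<Rightarrow> 'm) \<Rightarrow> nat \<Rightarrow> nat \<Rightarrow> nat \<Rightarrow> 'm" where
  "alg_pw X T A n k l =
     (let t = VHom T k l; a = Pw V X k; b = Pw V X l; an = Pw V a n in
      curry V t an
        (tuple V (t \<otimes> an) b n
          (\<lambda>i. Ev V a b \<cdot> \<langle>A k l \<cdot> Fst V t an, Pr V a n i \<cdot> Snd V t an\<rangle>)))"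

text \<open>\<open>S\<close> with \<open>B\<close> is the commutant of \<open>T\<close> with \<open>A\<close>, which is determined up to a unique
  isomorphism over \<open>full_theory X\<close>: \<open>VHom S n m\<close> is the object of natural transformations from the
  \<open>n\<close>-th to the \<open>m\<close>-th power of the algebra \<open>A\<close>; the evaluations \<open>p n m k\<close> at each \<open>k\<close> preserve
  composition, identities and projections, that is, these are given as in the enriched category
  of algebras; and \<open>B\<close> is the evaluation at \<open>1\<close>, i.e. the forgetful morphism to the homs of
  the carriers (recall \<open>Pw V X 1 = X\<close>).\<close>

definition is_commutant ::
    "'o \<Rightarrow> ('o, 'm) thy \<Rightarrow> (nat \<Rightarrow> nat \<Rightarrow> 'm) \<Rightarrow> ('o, 'm) thy \<Rightarrow> (nat \<Rightarrow> nat \<Rightarrow> 'm) \<Rightarrow> bool" where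
  "is_commutant X T A S B \<longleftrightarrow> is_theory_over X T A \<and> is_theory_over X S B \<and>
     (\<exists>p. (\<forall>n m. is_nat_object V T
               (\<lambda>k. Pw V (Pw V X k) n) (alg_pw X T A n)
               (\<lambda>k. Pw V (Pw V X k) m) (alg_pw X T A m)
               (VHom S n m) (p n m)) \<and>
          (\<forall>k. is_theory_morphism S (full_theory (Pw V X k)) (\<lambda>n m. p n m k)) \<and>
          (\<forall>n m. B n m = p n m 1))"

text \<open>As commutants are unique up to isomorphism over \<open>full_theory X\<close>, the choice of the
  commutants \<open>S\<close> and \<open>U\<close> below is immaterial.\<close>

definition is_saturated :: "'o \<Rightarrow> ('o, 'm) thy \<Rightarrow> (nat \<Rightarrow> nat \<Rightarrow> 'm) \<Rightarrow> bool" where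
  "is_saturated X T A \<longleftrightarrow>
     (\<exists>S B U C. is_commutant X T A S B \<and> is_commutant X S B U C \<and> iso_over X U C T A)"

definition is_balanced :: "'o \<Rightarrow> ('o, 'm) thy \<Rightarrow> (nat \<Rightarrow> nat \<Rightarrow> 'm) \<Rightarrow> bool" where
  "is_balanced X T A \<longleftrightarrow> (\<exists>S B. is_commutant X T A S B \<and> iso_over X S B T A)"

end


section \<open>Rigs and matrices\<close>

record ('o, 'm) rig =
  Car :: "'o"
  Add :: "'m"
  Zer :: "'m"
  Mul :: "'m"
  Uni :: "'m"

context
  fixes V :: "('o, 'm) ccc" (structure)
    and R :: "('o, 'm) rig"
begin

text \<open>Rig operations on generalized elements.\<close>

definition radd :: "'m \<Rightarrow> 'm \<Rightarrow> 'm" where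
  "radd x y = Add R \<cdot> \<langle>x, y\<rangle>"

definition rmul :: "'m \<Rightarrow> 'm \<Rightarrow> 'm" where
  "rmul x y = Mul R \<cdot> \<langle>x, y\<rangle>"

primrec rsum :: "'o \<Rightarrow> (nat \<Rightarrow> 'm) \<Rightarrow> nat \<Rightarrow> 'm" where
  "rsum z f 0 = const V z (Zer R)"
| "rsum z f (Suc n) = radd (rsum z f n) (f n)"

definition is_rig :: bool where
  "is_rig \<longleftrightarrow> Car R \<in> Obj V \<and>
     Add R \<in> hom V (Car R \<otimes> Car R) (Car R) \<and> Zer R \<in> hom V (One V) (Car R) \<and>
     Mul R \<in> hom V (Car R \<otimes> Car R) (Car R) \<and> Uni R \<in> hom V (One V) (Car R) \<and>
     (\<forall>z \<in> Obj V. \<forall>x \<in> hom V z (Car R). \<forall>y \<in> hom V z (Car R). \<forall>w \<in> hom V z (Car R).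
        radd (radd x y) w = radd x (radd y w) \<and>
        radd x y = radd y x \<and>
        radd (const V z (Zer R)) x = x \<and>
        rmul (rmul x y) w = rmul x (rmul y w) \<and>
        rmul (const V z (Uni R)) x = x \<and>
        rmul x (const V z (Uni R)) = x \<and>
        rmul x (radd y w) = radd (rmul x y) (rmul x w) \<and>
        rmul (radd x y) w = radd (rmul x w) (rmul y w) \<and>
        rmul x (const V z (Zer R)) = const V z (Zer R) \<and>
        rmul (const V z (Zer R)) x = const V z (Zer R))"

definition is_commutative_rig :: bool where
  "is_commutative_rig \<longleftrightarrow> is_rig \<and>
     (\<forall>z \<in> Obj V. \<forall>x \<in> hom V z (Car R). \<forall>y \<in> hom V z (Car R). rmul x y = rmul y x)"

text \<open>The object of \<open>m \<times> n\<close> matrices consists of \<open>m\<close> rows of length \<open>n\<close>; \<open>entry n m a j i\<close> is the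
  entry of \<open>a\<close> in row \<open>j\<close> and column \<open>i\<close>.\<close>

definition mat_obj :: "nat \<Rightarrow> nat \<Rightarrow> 'o" where
  "mat_obj n m = Pw V (Pw V (Car R) n) m"

definition entry :: "nat \<Rightarrow> nat \<Rightarrow> 'm \<Rightarrow> nat \<Rightarrow> nat \<Rightarrow> 'm" where
  "entry n m a j i = Pr V (Car R) n i \<cdot> (Pr V (Pw V (Car R) n) m j \<cdot> a)"

definition matrix :: "'o \<Rightarrow> nat \<Rightarrow> nat \<Rightarrow> (nat \<Rightarrow> nat \<Rightarrow> 'm) \<Rightarrow> 'm" where
  "matrix z n m f = tuple V z (Pw V (Car R) n) m (\<lambda>j. tuple V z (Car R) n (f j))"

definition Mat :: "('o, 'm) thy" where
  "Mat = \<lparr>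
     VObj = UNIV,
     VHom = mat_obj,
     VId = (\<lambda>n. matrix (One V) n n (\<lambda>j i. if j = i then Uni R else Zer R)),
     VComp = (\<lambda>n m l.
        let z = mat_obj m l \<otimes> mat_obj n m;
            b = Fst V (mat_obj m l) (mat_obj n m);
            a = Snd V (mat_obj m l) (mat_obj n m)
        in matrix z n l (\<lambda>k i. rsum z (\<lambda>j. rmul (entry m l b k j) (entry n m a j i)) m)),
     Proj = (\<lambda>n i. matrix (One V) n 1 (\<lambda>_ k. if k = i then Uni R else Zer R)) \<rparr>"

text \<open>The morphism \<open>a \<mapsto> (x \<mapsto> a x)\<close> that makes \<open>Mat\<close> a theory over \<open>full_theory V (Car R)\<close>.\<close>

definition mat_act :: "nat \<Rightarrow> nat \<Rightarrow> 'm" where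
  "mat_act n m =
     (let x = Pw V (Car R) n; z = mat_obj n m \<otimes> x in
      curry V (mat_obj n m) x
        (tuple V z (Car R) m
          (\<lambda>j. rsum z
             (\<lambda>i. rmul (entry n m (Fst V (mat_obj n m) x) j i)
                       (Pr V (Car R) n i \<cdot> Snd V (mat_obj n m) x)) n)))"

end

end

theory Submission
  imports Defs
begin

text \<open>
  The commutant of \<open>Mat V R\<close> is \<open>Mat V (op_rig V R)\<close>, the theory of matrices over the opposite rig
  (\<open>Mat_commutant\<close>). Indeed a map between powers of \<open>R\<close> that commutes with linear combinations with
  coefficients on the left is determined by its values at the unit vectors, and hence combines the
  coordinates with coefficients on the right. As the opposite of the opposite rig is \<open>R\<close>, the
  double commutant of \<open>Mat V R\<close> is \<open>Mat V R\<close>, over the full theory; and a commutative rig is its own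
  opposite, so in that case the first commutant is \<open>Mat V R\<close> already.

  Two devices make this argument work in an arbitrary cartesian closed category. The first is to
  compute with generalized elements. A morphism into an exponential is determined by its values
  \<open>app\<close> at elements of all stages (\<open>exp_ext\<close>), and a matrix at a fixed stage by its entries
  (\<open>mat_eqI\<close>); so every identity comes down to one between finite sums in the rig of elements of
  \<open>Car R\<close> at one stage. The other is that the hom-object of \<open>Mat V R\<close> from \<open>k\<close> to \<open>n\<close> is literally
  the \<open>n\<close>-th power of \<open>Pw V (Car R) k\<close>. Hence the hom functor at \<open>k\<close>, acting by matrix
  multiplication, is an algebra with carrier \<open>Pw V (Car R) k\<close> whose functoriality is nothing but
  associativity (\<open>postcomp_theory_morphism\<close>). For \<open>k = 1\<close> this algebra is \<open>mat_act\<close>, and for the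
  opposite rig these functors are the evaluations of the commutant at all \<open>k\<close>.

  The mathematical content lies in two facts. Multiplications from the left and from the right
  commute (\<open>opmul_pw_act\<close>), so that matrices over the opposite rig are natural transformations. And
  every natural family is given by such a matrix (\<open>ev_at_universal\<close>): naturality with respect to the
  projections reduces all components to the one at \<open>1\<close>, and naturality with respect to a row
  vector, applied to the identity matrix, shows that this component is linear.
\<close>

section \<open>Generalized elements of powers and exponentials\<close>

locale ccc_elements = cartesian_closed V
  for V :: "('o, 'm) ccc" (structure)
begin

lemma hom_obj:
  assumes "f \<in> hom V a b"
  shows "a \<in> Obj V" "b \<in> Obj V"
  using assms src_obj tgt_obj unfolding hom_def by auto

lemma hom_Src: "f \<in> hom V a b \<Longrightarrow> Src V f = a"
  and hom_Tgt: "f \<in> hom V a b \<Longrightarrow> Tgt V f = b"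
  by (simp_all add: hom_def)

declare comp_hom [intro] ide_hom [intro] hom_obj [dest]
declare fst_hom [intro] snd_hom [intro] prod_obj [intro] exp_obj [intro] pw_obj [intro] ev_hom [intro]
declare one_obj [intro] pr_hom [intro]

lemma pair_props:
  assumes "f \<in> hom V z a" "g \<in> hom V z b"
  shows "\<langle>f, g\<rangle> \<in> hom V z (a \<otimes> b) \<and> Fst V a b \<cdot> \<langle>f, g\<rangle> = f \<and> Snd V a b \<cdot> \<langle>f, g\<rangle> = g"
  using theI'[OF prod_univ[OF assms]] assms
  by (simp add: pair_def hom_Src[OF assms(1)] hom_Tgt[OF assms(1)] hom_Tgt[OF assms(2)])

lemma pair_hom [intro]: "f \<in> hom V z a \<Longrightarrow> g \<in> hom V z b \<Longrightarrow> \<langle>f, g\<rangle> \<in> hom V z (a \<otimes> b)"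
  and fst_pair: "f \<in> hom V z a \<Longrightarrow> g \<in> hom V z b \<Longrightarrow> Fst V a b \<cdot> \<langle>f, g\<rangle> = f"
  and snd_pair: "f \<in> hom V z a \<Longrightarrow> g \<in> hom V z b \<Longrightarrow> Snd V a b \<cdot> \<langle>f, g\<rangle> = g"
  using pair_props by auto

lemma pair_eqI:
  assumes "h \<in> hom V z (a \<otimes> b)" "k \<in> hom V z (a \<otimes> b)" "a \<in> Obj V" "b \<in> Obj V"
    and "Fst V a b \<cdot> h = Fst V a b \<cdot> k" "Snd V a b \<cdot> h = Snd V a b \<cdot> k"
  shows "h = k"
proof -
  have "Fst V a b \<cdot> k \<in> hom V z a" "Snd V a b \<cdot> k \<in> hom V z b"
    using assms by blast+
  from prod_univ[OF this] show ?thesis using assms by blast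
qed

lemma pair_comp:
  assumes f: "f \<in> hom V z a" and g: "g \<in> hom V z b" and s: "s \<in> hom V w z"
  shows "\<langle>f, g\<rangle> \<cdot> s = \<langle>f \<cdot> s, g \<cdot> s\<rangle>"
proof (rule pair_eqI)
  have a: "a \<in> Obj V" "b \<in> Obj V" using f g by auto
  then show "a \<in> Obj V" "b \<in> Obj V" by auto
  show "\<langle>f, g\<rangle> \<cdot> s \<in> hom V w (a \<otimes> b)" "\<langle>f \<cdot> s, g \<cdot> s\<rangle> \<in> hom V w (a \<otimes> b)"
    using assms by blast+
  have p: "\<langle>f, g\<rangle> \<in> hom V z (a \<otimes> b)" using assms by blast
  show "Fst V a b \<cdot> (\<langle>f, g\<rangle> \<cdot> s) = Fst V a b \<cdot> \<langle>f \<cdot> s, g \<cdot> s\<rangle>"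
    using comp_assoc[OF s p fst_hom[OF a]] fst_pair[OF f g]
      fst_pair[OF comp_hom[OF s f] comp_hom[OF s g]] by simp
  show "Snd V a b \<cdot> (\<langle>f, g\<rangle> \<cdot> s) = Snd V a b \<cdot> \<langle>f \<cdot> s, g \<cdot> s\<rangle>"
    using comp_assoc[OF s p snd_hom[OF a]] snd_pair[OF f g]
      snd_pair[OF comp_hom[OF s f] comp_hom[OF s g]] by simp
qed

lemma tuple_props:
  assumes "z \<in> Obj V" "x \<in> Obj V" "\<And>i. i < n \<Longrightarrow> f i \<in> hom V z x"
  shows "tuple V z x n f \<in> hom V z (Pw V x n) \<and> (\<forall>i<n. Pr V x n i \<cdot> tuple V z x n f = f i)"
  unfolding tuple_def by (rule theI'[OF pw_univ]) (use assms in auto)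

lemma tuple_hom [intro]:
    "\<lbrakk>z \<in> Obj V; x \<in> Obj V; \<And>i. i < n \<Longrightarrow> f i \<in> hom V z x\<rbrakk> \<Longrightarrow> tuple V z x n f \<in> hom V z (Pw V x n)"
  and pr_tuple: "\<lbrakk>z \<in> Obj V; x \<in> Obj V; \<And>i. i < n \<Longrightarrow> f i \<in> hom V z x; i < n\<rbrakk>
    \<Longrightarrow> Pr V x n i \<cdot> tuple V z x n f = f i"
  using tuple_props by auto

lemma tuple_eqI:
  assumes "h \<in> hom V z (Pw V x n)" "k \<in> hom V z (Pw V x n)" "x \<in> Obj V"
    and "\<And>i. i < n \<Longrightarrow> Pr V x n i \<cdot> h = Pr V x n i \<cdot> k"
  shows "h = k"
proof -
  have "z \<in> Obj V" using assms(1) by auto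
  then have "\<exists>!h. h \<in> hom V z (Pw V x n) \<and> (\<forall>i<n. Pr V x n i \<cdot> h = Pr V x n i \<cdot> k)"
    by (rule pw_univ) (use assms in blast)+
  then show ?thesis using assms(1,2,4) by blast
qed

lemma bang_hom [intro]: "z \<in> Obj V \<Longrightarrow> bang V z \<in> hom V z (One V)"
  unfolding bang_def using theI'[OF one_univ] .

lemma const_hom [intro]: "z \<in> Obj V \<Longrightarrow> e \<in> hom V (One V) b \<Longrightarrow> const V z e \<in> hom V z b"
  unfolding const_def by blast

lemma const_comp:
  assumes e: "e \<in> hom V (One V) b" and s: "s \<in> hom V w z"
  shows "const V z e \<cdot> s = const V w e"
proof -
  have z: "z \<in> Obj V" "w \<in> Obj V" using s by auto
  have "bang V z \<cdot> s = bang V w"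
    using one_univ[OF z(2)] bang_hom[OF z(1)] bang_hom[OF z(2)] s by blast
  then show ?thesis
    unfolding const_def using comp_assoc[OF s bang_hom[OF z(1)] e] by simp
qed

lemma const_One:
  assumes e: "e \<in> hom V (One V) b"
  shows "const V (One V) e = e"
proof -
  have "bang V (One V) = Ide V (One V)"
    using one_univ[OF one_obj] bang_hom[OF one_obj] ide_hom[OF one_obj] by blast
  then show ?thesis unfolding const_def using ide_right[OF e] by simp
qed

definition app :: "'o \<Rightarrow> 'o \<Rightarrow> 'm \<Rightarrow> 'm \<Rightarrow> 'm" where
  "app a b f x = Ev V a b \<cdot> \<langle>f, x\<rangle>"

lemma app_hom [intro]:
  "\<lbrakk>f \<in> hom V z (Exp V a b); x \<in> hom V z a; b \<in> Obj V\<rbrakk> \<Longrightarrow> app a b f x \<in> hom V z b"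
  unfolding app_def by (rule comp_hom[OF pair_hom ev_hom]) auto

lemma app_comp:
  assumes "f \<in> hom V z (Exp V a b)" "x \<in> hom V z a" "b \<in> Obj V" "s \<in> hom V w z"
  shows "app a b f x \<cdot> s = app a b (f \<cdot> s) (x \<cdot> s)"
  unfolding app_def pair_comp[OF assms(1,2,4), symmetric]
  by (rule comp_assoc[symmetric]) (use assms in blast)+

lemma curry_props:
  assumes "z \<in> Obj V" "a \<in> Obj V" "f \<in> hom V (z \<otimes> a) b"
  shows "curry V z a f \<in> hom V z (Exp V a b) \<and>
    Ev V a b \<cdot> \<langle>curry V z a f \<cdot> Fst V z a, Snd V z a\<rangle> = f"
  unfolding curry_def hom_Tgt[OF assms(3)] by (rule theI'[OF exp_univ[OF assms]])

lemma curry_hom [intro]: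
  "\<lbrakk>z \<in> Obj V; a \<in> Obj V; f \<in> hom V (z \<otimes> a) b\<rbrakk> \<Longrightarrow> curry V z a f \<in> hom V z (Exp V a b)"
  using curry_props by auto

lemma ev_shift:
  assumes h: "h \<in> hom V z (Exp V a b)" and s: "s \<in> hom V w z" and x: "x \<in> hom V w a"
    and b: "b \<in> Obj V"
  shows "(Ev V a b \<cdot> \<langle>h \<cdot> Fst V z a, Snd V z a\<rangle>) \<cdot> \<langle>s, x\<rangle> = app a b (h \<cdot> s) x"
proof -
  have o: "z \<in> Obj V" "a \<in> Obj V" using s x by auto
  have f: "Fst V z a \<in> hom V (z \<otimes> a) z" "Snd V z a \<in> hom V (z \<otimes> a) a"
    "\<langle>s, x\<rangle> \<in> hom V w (z \<otimes> a)" using o s x by auto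
  have "app a b (h \<cdot> Fst V z a) (Snd V z a) \<cdot> \<langle>s, x\<rangle>
      = app a b ((h \<cdot> Fst V z a) \<cdot> \<langle>s, x\<rangle>) (Snd V z a \<cdot> \<langle>s, x\<rangle>)"
    by (rule app_comp) (use f b h in blast)+
  also have "(h \<cdot> Fst V z a) \<cdot> \<langle>s, x\<rangle> = h \<cdot> s"
    using comp_assoc[OF f(3) f(1) h] fst_pair[OF s x] by simp
  also have "Snd V z a \<cdot> \<langle>s, x\<rangle> = x" using snd_pair[OF s x] .
  finally show ?thesis unfolding app_def .
qed

lemma app_curry:
  assumes f: "f \<in> hom V (z \<otimes> a) b" and s: "s \<in> hom V w z" and x: "x \<in> hom V w a"
  shows "app a b (curry V z a f \<cdot> s) x = f \<cdot> \<langle>s, x\<rangle>"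
proof -
  have o: "z \<in> Obj V" "a \<in> Obj V" "b \<in> Obj V" using s x f by auto
  show ?thesis
    using ev_shift[OF curry_hom[OF o(1,2) f] s x o(3)] curry_props[OF o(1,2) f] by simp
qed

text \<open>It is enough to evaluate at the generic stage \<open>z \<otimes> a\<close>, at the two projections: there the hypothesis
  is the equation that determines a morphism into the exponential.\<close>

lemma exp_ext:
  assumes h: "h \<in> hom V z (Exp V a b)" and k: "k \<in> hom V z (Exp V a b)"
    and o: "a \<in> Obj V" "b \<in> Obj V"
    and eq: "\<And>w s x. \<lbrakk>w \<in> Obj V; s \<in> hom V w z; x \<in> hom V w a\<rbrakk> \<Longrightarrow> app a b (h \<cdot> s) x = app a b (k \<cdot> s) x"
  shows "h = k"
proof -
  have z: "z \<in> Obj V" using h by auto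
  have za: "z \<otimes> a \<in> Obj V" using z o by auto
  have "Ev V a b \<cdot> \<langle>h \<cdot> Fst V z a, Snd V z a\<rangle> = Ev V a b \<cdot> \<langle>k \<cdot> Fst V z a, Snd V z a\<rangle>"
    using eq[OF za fst_hom[OF z o(1)] snd_hom[OF z o(1)]] unfolding app_def .
  moreover have "Ev V a b \<cdot> \<langle>k \<cdot> Fst V z a, Snd V z a\<rangle> \<in> hom V (z \<otimes> a) b"
    by (rule comp_hom[OF pair_hom ev_hom]) (use z o k in blast)+
  from exp_univ[OF z o(1) this] show ?thesis using h k calculation by blast
qed

lemma name_of_hom [intro]:
  assumes f: "f \<in> hom V a b"
  shows "name_of V f \<in> hom V (One V) (Exp V a b)"
  unfolding name_of_def hom_Src[OF f] by (rule curry_hom) (use f in blast)+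

lemma app_name_of:
  assumes f: "f \<in> hom V a b" and x: "x \<in> hom V z a"
  shows "app a b (const V z (name_of V f)) x = f \<cdot> x"
proof -
  have o: "a \<in> Obj V" "z \<in> Obj V" using f x by auto
  have h: "f \<cdot> Snd V (One V) a \<in> hom V (One V \<otimes> a) b" using f o by blast
  have "app a b (const V z (name_of V f)) x = (f \<cdot> Snd V (One V) a) \<cdot> \<langle>bang V z, x\<rangle>"
    unfolding const_def name_of_def hom_Src[OF f]
    by (rule app_curry[OF h bang_hom[OF o(2)] x])
  also have "\<dots> = f \<cdot> (Snd V (One V) a \<cdot> \<langle>bang V z, x\<rangle>)"
    by (rule comp_assoc[symmetric]) (use f o x in blast)+
  also have "\<dots> = f \<cdot> x" using snd_pair[OF bang_hom[OF o(2)] x] by simp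
  finally show ?thesis .
qed

section \<open>The self-enrichment\<close>

lemma vcomp_hom:
  assumes "VComp C a b c \<in> hom V (VHom C b c \<otimes> VHom C a b) (VHom C a c)"
    and "f \<in> hom V z (VHom C a b)" "g \<in> hom V z (VHom C b c)"
  shows "vcomp V C a b c g f \<in> hom V z (VHom C a c)"
  unfolding vcomp_def using assms by blast

lemma vcomp_comp:
  assumes "VComp C a b c \<in> hom V (VHom C b c \<otimes> VHom C a b) (VHom C a c)"
    and "f \<in> hom V z (VHom C a b)" "g \<in> hom V z (VHom C b c)" "s \<in> hom V w z"
  shows "vcomp V C a b c g f \<cdot> s = vcomp V C a b c (g \<cdot> s) (f \<cdot> s)"
  unfolding vcomp_def pair_comp[OF assms(3,2,4), symmetric]
  by (rule comp_assoc[symmetric]) (use assms in blast)+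

lemma self_sel: "VObj (self_vcat V) = Obj V" "VHom (self_vcat V) = Exp V"
    "VId (self_vcat V) a = name_of V (Ide V a)"
  by (simp_all add: self_vcat_def)

lemma self_comp:
  assumes o: "a \<in> Obj V" "b \<in> Obj V" "c \<in> Obj V"
  shows self_VComp_hom: "VComp (self_vcat V) a b c \<in> hom V (Exp V b c \<otimes> Exp V a b) (Exp V a c)"
    and app_self_VComp: "\<And>g f w x. \<lbrakk>g \<in> hom V w (Exp V b c); f \<in> hom V w (Exp V a b); x \<in> hom V w a\<rbrakk>
      \<Longrightarrow> app a c (vcomp V (self_vcat V) a b c g f) x = app b c g (app a b f x)"
proof -
  define z where "z = Exp V b c \<otimes> Exp V a b"
  define F where "F = Fst V (Exp V b c) (Exp V a b) \<cdot> Fst V z a"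
  define S where "S = Snd V (Exp V b c) (Exp V a b) \<cdot> Fst V z a"
  define T where "T = Snd V z a"
  have ex: "Exp V b c \<in> Obj V" "Exp V a b \<in> Obj V" and z: "z \<in> Obj V"
    using o by (auto simp: z_def)
  have F: "F \<in> hom V (z \<otimes> a) (Exp V b c)" unfolding F_def
    by (rule comp_hom[OF fst_hom[OF z o(1)]]) (simp add: z_def fst_hom ex)
  have S: "S \<in> hom V (z \<otimes> a) (Exp V a b)" unfolding S_def
    by (rule comp_hom[OF fst_hom[OF z o(1)]]) (simp add: z_def snd_hom ex)
  have T: "T \<in> hom V (z \<otimes> a) a" unfolding T_def using z o by blast
  have body: "app b c F (app a b S T) \<in> hom V (z \<otimes> a) c" using F S T o by blast
  have VC: "VComp (self_vcat V) a b c = curry V z a (app b c F (app a b S T))"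
    by (simp add: self_vcat_def Let_def app_def F_def S_def T_def z_def)
  show "VComp (self_vcat V) a b c \<in> hom V (Exp V b c \<otimes> Exp V a b) (Exp V a c)"
    unfolding VC z_def[symmetric] using z o body by blast
  fix g f w x
  assume g: "g \<in> hom V w (Exp V b c)" and f: "f \<in> hom V w (Exp V a b)" and x: "x \<in> hom V w a"
  have gf: "\<langle>g, f\<rangle> \<in> hom V w z" unfolding z_def using f g by blast
  let ?s = "\<langle>\<langle>g, f\<rangle>, x\<rangle>"
  have s: "?s \<in> hom V w (z \<otimes> a)" using gf x by blast
  have "app a c (vcomp V (self_vcat V) a b c g f) x = app b c F (app a b S T) \<cdot> ?s"
    unfolding vcomp_def VC by (rule app_curry[OF body gf x])
  also have "\<dots> = app b c (F \<cdot> ?s) (app a b (S \<cdot> ?s) (T \<cdot> ?s))"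
    using app_comp[OF F app_hom[OF S T o(2)] o(3) s] app_comp[OF S T o(2) s] by simp
  also have "F \<cdot> ?s = g" unfolding F_def
    using comp_assoc[OF s fst_hom[OF z o(1)], of "Fst V (Exp V b c) (Exp V a b)" "Exp V b c"]
      fst_hom[OF ex] fst_pair[OF gf x] fst_pair[OF g f] by (simp add: z_def)
  also have "S \<cdot> ?s = f" unfolding S_def
    using comp_assoc[OF s fst_hom[OF z o(1)], of "Snd V (Exp V b c) (Exp V a b)" "Exp V a b"]
      snd_hom[OF ex] fst_pair[OF gf x] snd_pair[OF g f] by (simp add: z_def)
  also have "T \<cdot> ?s = x" unfolding T_def by (rule snd_pair[OF gf x])
  finally show "app a c (vcomp V (self_vcat V) a b c g f) x = app b c g (app a b f x)" .
qed

lemma self_vcomp_hom: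
  assumes "g \<in> hom V w (Exp V b c)" "f \<in> hom V w (Exp V a b)" "a \<in> Obj V" "b \<in> Obj V" "c \<in> Obj V"
  shows "vcomp V (self_vcat V) a b c g f \<in> hom V w (Exp V a c)"
  unfolding vcomp_def using assms self_VComp_hom by blast

lemma self_vcomp_comp:
  assumes "g \<in> hom V z (Exp V b c)" "f \<in> hom V z (Exp V a b)" "a \<in> Obj V" "b \<in> Obj V" "c \<in> Obj V"
    "s \<in> hom V w z"
  shows "vcomp V (self_vcat V) a b c g f \<cdot> s = vcomp V (self_vcat V) a b c (g \<cdot> s) (f \<cdot> s)"
  by (rule vcomp_comp) (use assms self_VComp_hom in \<open>auto simp: self_sel\<close>)

text \<open>Composites in the self-enrichment never have to be unfolded: on values they are composites of
  functions, and values determine a morphism into an exponential.\<close>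

lemma self_vcomp_eqI:
  assumes g: "g \<in> hom V z (Exp V b c)" and f: "f \<in> hom V z (Exp V a b)"
    and k: "k \<in> hom V z (Exp V a c)"
    and o: "a \<in> Obj V" "b \<in> Obj V" "c \<in> Obj V"
    and eq: "\<And>w s x. \<lbrakk>w \<in> Obj V; s \<in> hom V w z; x \<in> hom V w a\<rbrakk>
       \<Longrightarrow> app b c (g \<cdot> s) (app a b (f \<cdot> s) x) = app a c (k \<cdot> s) x"
  shows "vcomp V (self_vcat V) a b c g f = k"
proof (rule exp_ext[OF self_vcomp_hom k])
  fix w s x assume "w \<in> Obj V" and s: "s \<in> hom V w z" and x: "x \<in> hom V w a"
  have "app a c (vcomp V (self_vcat V) a b c g f \<cdot> s) x = app b c (g \<cdot> s) (app a b (f \<cdot> s) x)"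
    unfolding self_vcomp_comp[OF g f o s]
    by (rule app_self_VComp) (use o g f s x in blast)+
  then show "app a c (vcomp V (self_vcat V) a b c g f \<cdot> s) x = app a c (k \<cdot> s) x"
    using eq[OF _ s x] hom_obj[OF s] by simp
qed (use o f g in auto)

lemma self_is_vcategory: "is_vcategory V (self_vcat V)"
  unfolding is_vcategory_def self_sel
proof (intro conjI ballI)
  fix a b assume "a \<in> Obj V" "b \<in> Obj V" then show "Exp V a b \<in> Obj V" by auto
next
  fix a assume "a \<in> Obj V" then show "name_of V (Ide V a) \<in> hom V (One V) (Exp V a a)" by auto
next
  fix a b c assume "a \<in> Obj V" "b \<in> Obj V" "c \<in> Obj V"
  then show "VComp (self_vcat V) a b c \<in> hom V (Exp V b c \<otimes> Exp V a b) (Exp V a c)"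
    by (rule self_VComp_hom)
next
  fix a b z f assume a: "a \<in> Obj V" and b: "b \<in> Obj V" and z: "z \<in> Obj V"
    and f: "f \<in> hom V z (Exp V a b)"
  have id: "name_of V (Ide V c) \<in> hom V (One V) (Exp V c c)" if "c \<in> Obj V" for c
    using that by auto
  have n: "app c c (const V z (name_of V (Ide V c)) \<cdot> s) x = x"
    if "s \<in> hom V w z" "x \<in> hom V w c" for c w s x
  proof -
    have c: "c \<in> Obj V" using that by auto
    show ?thesis
      unfolding const_comp[OF id[OF c] that(1)] app_name_of[OF ide_hom[OF c] that(2)]
      by (rule ide_left[OF that(2)])
  qed
  show "vcomp V (self_vcat V) a b b (const V z (name_of V (Ide V b))) f = f"
    by (rule self_vcomp_eqI) (use a b z f id in \<open>auto intro!: n\<close>)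
  show "vcomp V (self_vcat V) a a b f (const V z (name_of V (Ide V a))) = f"
    by (rule self_vcomp_eqI) (use a b z f id in \<open>auto simp: n\<close>)
next
  fix a b c d z f g h
  assume o: "a \<in> Obj V" "b \<in> Obj V" "c \<in> Obj V" "d \<in> Obj V" and z: "z \<in> Obj V"
    and f: "f \<in> hom V z (Exp V a b)" and g: "g \<in> hom V z (Exp V b c)" and h: "h \<in> hom V z (Exp V c d)"
  show "vcomp V (self_vcat V) a c d h (vcomp V (self_vcat V) a b c g f) =
        vcomp V (self_vcat V) a b d (vcomp V (self_vcat V) b c d h g) f"
  proof (rule self_vcomp_eqI[OF h self_vcomp_hom[OF g f o(1-3)] self_vcomp_hom[OF self_vcomp_hom[OF h g o(2-4)] f o(1,2,4)] o(1,3,4)])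
    fix w s x assume s: "s \<in> hom V w z" and x: "x \<in> hom V w a"
    have fs: "f \<cdot> s \<in> hom V w (Exp V a b)" "g \<cdot> s \<in> hom V w (Exp V b c)" "h \<cdot> s \<in> hom V w (Exp V c d)"
      using f g h s by blast+
    show "app c d (h \<cdot> s) (app a c (vcomp V (self_vcat V) a b c g f \<cdot> s) x) =
       app a d (vcomp V (self_vcat V) a b d (vcomp V (self_vcat V) b c d h g) f \<cdot> s) x"
      unfolding self_vcomp_comp[OF g f o(1-3) s] self_vcomp_comp[OF self_vcomp_hom[OF h g o(2-4)] f o(1,2,4) s]
        self_vcomp_comp[OF h g o(2-4) s]
        app_self_VComp[OF o(1-3) fs(2,1) x]
        app_self_VComp[OF o(1,2,4) self_vcomp_hom[OF fs(3,2) o(2-4)] fs(1) x]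
        app_self_VComp[OF o(2-4) fs(3,2) app_hom[OF fs(1) x o(2)]] ..
  qed
qed

lemma curry_tuple:
  assumes o: "z \<in> Obj V" "a \<in> Obj V" "b \<in> Obj V"
    and F: "\<And>i. i < n \<Longrightarrow> F i \<in> hom V (z \<otimes> a) b"
  shows curry_tuple_hom: "curry V z a (tuple V (z \<otimes> a) b n F) \<in> hom V z (Exp V a (Pw V b n))"
    and pr_app_curry_tuple: "\<And>w s x i. \<lbrakk>s \<in> hom V w z; x \<in> hom V w a; i < n\<rbrakk> \<Longrightarrow>
      Pr V b n i \<cdot> app a (Pw V b n) (curry V z a (tuple V (z \<otimes> a) b n F) \<cdot> s) x = F i \<cdot> \<langle>s, x\<rangle>"
proof -
  have za: "z \<otimes> a \<in> Obj V" using o by auto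
  have t: "tuple V (z \<otimes> a) b n F \<in> hom V (z \<otimes> a) (Pw V b n)"
    by (rule tuple_hom) (use za o F in auto)
  show "curry V z a (tuple V (z \<otimes> a) b n F) \<in> hom V z (Exp V a (Pw V b n))"
    by (rule curry_hom[OF o(1,2) t])
  fix w s x i assume s: "s \<in> hom V w z" and x: "x \<in> hom V w a" and i: "i < n"
  have "Pr V b n i \<cdot> tuple V (z \<otimes> a) b n F = F i"
    by (rule pr_tuple) (use za o F i in auto)
  then show "Pr V b n i \<cdot> app a (Pw V b n) (curry V z a (tuple V (z \<otimes> a) b n F) \<cdot> s) x = F i \<cdot> \<langle>s, x\<rangle>"
    unfolding app_curry[OF t s x]
    using comp_assoc[OF pair_hom[OF s x] t pr_hom[OF o(3) i]] by simp
qed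

lemma vcat_hom_obj: "\<lbrakk>is_vcategory V C; a \<in> VObj C; b \<in> VObj C\<rbrakk> \<Longrightarrow> VHom C a b \<in> Obj V"
  and vcat_VId: "\<lbrakk>is_vcategory V C; a \<in> VObj C\<rbrakk> \<Longrightarrow> VId C a \<in> hom V (One V) (VHom C a a)"
  and vcat_VComp: "\<lbrakk>is_vcategory V C; a \<in> VObj C; b \<in> VObj C; c \<in> VObj C\<rbrakk>
    \<Longrightarrow> VComp C a b c \<in> hom V (VHom C b c \<otimes> VHom C a b) (VHom C a c)"
  by (simp_all add: is_vcategory_def)

lemma vcat_left_id:
  assumes "is_vcategory V C" "a \<in> VObj C" "b \<in> VObj C" "f \<in> hom V z (VHom C a b)"
  shows "vcomp V C a b b (const V z (VId C b)) f = f"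
  using assms hom_obj(1)[OF assms(4)] by (simp add: is_vcategory_def)

lemma vcat_assoc:
  assumes "is_vcategory V C" "a \<in> VObj C" "b \<in> VObj C" "c \<in> VObj C" "d \<in> VObj C"
    "f \<in> hom V z (VHom C a b)" "g \<in> hom V z (VHom C b c)" "h \<in> hom V z (VHom C c d)"
  shows "vcomp V C a c d h (vcomp V C a b c g f) = vcomp V C a b d (vcomp V C b c d h g) f"
  using assms hom_obj(1)[OF assms(6)] by (simp add: is_vcategory_def)

section \<open>Enriched powers and full theories\<close>

text \<open>The isomorphism that an enriched power asks for is checked on generalized elements: the inverse
  is the unique tuple of the projections \<open>Pr V (VHom C d x) n i\<close>, taken at the stage which is the
  power itself. It is a left inverse because tuples are unique at the stage \<open>VHom C d c\<close>.\<close>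

lemma exhibits_powerI:
  assumes C: "is_vcategory V C" and c: "c \<in> VObj C" and x: "x \<in> VObj C"
    and p: "\<And>i. i < n \<Longrightarrow> p i \<in> hom V (One V) (VHom C c x)"
    and tup: "\<And>d z f. \<lbrakk>d \<in> VObj C; z \<in> Obj V; \<And>i. i < n \<Longrightarrow> f i \<in> hom V z (VHom C d x)\<rbrakk> \<Longrightarrow>
      \<exists>!h. h \<in> hom V z (VHom C d c) \<and> (\<forall>i<n. vcomp V C d c x (const V z (p i)) h = f i)"
  shows "exhibits_power V C c x n p"
  unfolding exhibits_power_def
proof (intro conjI ballI allI impI)
  fix d assume d: "d \<in> VObj C"
  define H where "H = VHom C d c"
  define K where "K = VHom C d x"
  define t where "t = tuple V H K n (\<lambda>i. vcomp V C d c x (const V H (p i)) (Ide V H))"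
  have H: "H \<in> Obj V" and K: "K \<in> Obj V"
    unfolding H_def K_def using vcat_hom_obj[OF C d c] vcat_hom_obj[OF C d x] by simp_all
  have VC: "VComp C d c x \<in> hom V (VHom C c x \<otimes> VHom C d c) (VHom C d x)"
    by (rule vcat_VComp[OF C d c x])
  have q: "vcomp V C d c x (const V z (p i)) h \<in> hom V z K"
    if "h \<in> hom V z H" "i < n" for z h i
    unfolding K_def
    by (rule vcomp_hom[OF VC]) (use that p H_def in \<open>auto intro!: const_hom\<close>)
  have idH: "Ide V H \<in> hom V H H" using H by auto
  have t: "t \<in> hom V H (Pw V K n)"
    unfolding t_def by (rule tuple_hom) (use H K q[OF idH] in auto)
  have prt: "Pr V K n i \<cdot> (t \<cdot> h) = vcomp V C d c x (const V z (p i)) h"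
    if h: "h \<in> hom V z H" and i: "i < n" for z h i
  proof -
    have "Pr V K n i \<cdot> t = vcomp V C d c x (const V H (p i)) (Ide V H)"
      unfolding t_def by (rule pr_tuple) (use H K i q[OF idH] in auto)
    then have "Pr V K n i \<cdot> (t \<cdot> h) = vcomp V C d c x (const V H (p i)) (Ide V H) \<cdot> h"
      using comp_assoc[OF h t pr_hom[OF K i]] by simp
    also have "\<dots> = vcomp V C d c x (const V H (p i) \<cdot> h) (Ide V H \<cdot> h)"
      by (rule vcomp_comp[OF VC]) (use idH H p[OF i] h in \<open>auto simp: H_def[symmetric]\<close>)
    finally show ?thesis
      using const_comp[OF p[OF i] h] ide_left[OF h] by simp
  qed
  obtain g where g: "g \<in> hom V (Pw V K n) H"
    and pg: "\<And>i. i < n \<Longrightarrow> vcomp V C d c x (const V (Pw V K n) (p i)) g = Pr V K n i"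
  proof -
    have "\<exists>!h. h \<in> hom V (Pw V K n) (VHom C d c) \<and>
        (\<forall>i<n. vcomp V C d c x (const V (Pw V K n) (p i)) h = Pr V K n i)"
      by (rule tup[OF d]) (use K pr_hom K_def in auto)
    then show ?thesis using that unfolding H_def by blast
  qed
  have tg: "t \<cdot> g = Ide V (Pw V K n)"
  proof (rule tuple_eqI[OF _ _ K])
    show "t \<cdot> g \<in> hom V (Pw V K n) (Pw V K n)" using t g by blast
    show "Ide V (Pw V K n) \<in> hom V (Pw V K n) (Pw V K n)" using K by blast
    fix i assume "i < n"
    then show "Pr V K n i \<cdot> (t \<cdot> g) = Pr V K n i \<cdot> Ide V (Pw V K n)"
      using prt[OF g] pg ide_right[OF pr_hom[OF K]] by simp
  qed
  have gt: "g \<cdot> t = Ide V H"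
  proof -
    have gt: "g \<cdot> t \<in> hom V H H" using g t by blast
    have "t \<cdot> (g \<cdot> t) = t \<cdot> Ide V H"
      using comp_assoc[OF t g t] ide_left[OF t] ide_right[OF t] tg by simp
    then have "vcomp V C d c x (const V H (p i)) (g \<cdot> t) = vcomp V C d c x (const V H (p i)) (Ide V H)"
      if "i < n" for i
      using prt[OF gt that] prt[OF idH that] by simp
    moreover have "\<exists>!h. h \<in> hom V H (VHom C d c) \<and>
        (\<forall>i<n. vcomp V C d c x (const V H (p i)) h = vcomp V C d c x (const V H (p i)) (Ide V H))"
      by (rule tup[OF d H]) (use q[OF idH] K_def in auto)
    ultimately show ?thesis using gt idH H_def by blast
  qed
  have "is_iso V t"
    unfolding is_iso_def hom_Src[OF t] hom_Tgt[OF t] using t g tg gt by (auto simp: hom_def)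
  then show "is_iso V (tuple V (VHom C d c) (VHom C d x) n
      (\<lambda>i. vcomp V C d c x (const V (VHom C d c) (p i)) (Ide V (VHom C d c))))"
    unfolding t_def H_def K_def .
qed (use c x p in auto)

lemma full_sel:
  "VObj (full_theory V X) = UNIV"
  "VHom (full_theory V X) n m = Exp V (Pw V X n) (Pw V X m)"
  "VId (full_theory V X) n = name_of V (Ide V (Pw V X n))"
  "VComp (full_theory V X) n m k = VComp (self_vcat V) (Pw V X n) (Pw V X m) (Pw V X k)"
  "vcomp V (full_theory V X) n m k g f = vcomp V (self_vcat V) (Pw V X n) (Pw V X m) (Pw V X k) g f"
  "Proj (full_theory V X) n i = name_of V (Pr V X n i)"
  by (simp_all add: full_theory_def self_sel vcomp_def)

lemma full_is_vcategory:
  assumes X: "X \<in> Obj V"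
  shows "is_vcategory V (full_theory V X)"
proof -
  have "Pw V X n \<in> Obj V" for n using X by auto
  then show ?thesis
    using self_is_vcategory by (simp add: is_vcategory_def full_sel self_sel)
qed

lemma app_full_Proj:
  assumes X: "X \<in> Obj V" and i: "i < n" and h: "h \<in> hom V z (Exp V a (Pw V X n))"
    and s: "s \<in> hom V w z" and x: "x \<in> hom V w a"
  shows "app a X (vcomp V (self_vcat V) a (Pw V X n) X (const V z (name_of V (Pr V X n i))) h \<cdot> s) x
    = Pr V X n i \<cdot> app a (Pw V X n) (h \<cdot> s) x"
proof -
  have o: "a \<in> Obj V" "Pw V X n \<in> Obj V" "z \<in> Obj V" "w \<in> Obj V" using X x s by auto
  have nm: "name_of V (Pr V X n i) \<in> hom V (One V) (Exp V (Pw V X n) X)" using X i by auto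
  have hs: "h \<cdot> s \<in> hom V w (Exp V a (Pw V X n))" using h s by blast
  show ?thesis
    unfolding self_vcomp_comp[OF const_hom[OF o(3) nm] h o(1,2) X s] const_comp[OF nm s]
      app_self_VComp[OF o(1,2) X const_hom[OF o(4) nm] hs x]
    by (rule app_name_of) (use X i hs x o in auto)
qed

text \<open>Tuples are formed value by value: at the generic stage one takes the tuple of the values and
  curries the result.\<close>

lemma full_is_theory:
  assumes X: "X \<in> Obj V"
  shows "is_theory V (full_theory V X)"
  unfolding is_theory_def
proof (intro conjI allI)
  show "is_vcategory V (full_theory V X)" using full_is_vcategory[OF X] .
  show "VObj (full_theory V X) = UNIV" by (simp add: full_sel)
  show "Proj (full_theory V X) 1 0 = VId (full_theory V X) 1"
    using pw_1[OF X] pr_1[OF X] by (simp add: full_sel)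
  fix n
  have X1: "Pw V X (Suc 0) = X" using pw_1[OF X] by simp
  show "exhibits_power V (full_theory V X) n 1 n (Proj (full_theory V X) n)"
  proof (rule exhibits_powerI[OF full_is_vcategory[OF X]]; (unfold full_sel pw_1[OF X])?)
    fix i assume "i < n"
    then show "name_of V (Pr V X n i) \<in> hom V (One V) (Exp V (Pw V X n) X)" using X by auto
  next
    fix d z f
    assume z: "z \<in> Obj V" and f: "\<And>i. i < n \<Longrightarrow> f i \<in> hom V z (Exp V (Pw V X d) X)"
    let ?a = "Pw V X d"
    let ?P = "\<lambda>h. h \<in> hom V z (Exp V ?a (Pw V X n)) \<and>
      (\<forall>i<n. vcomp V (self_vcat V) ?a (Pw V X n) X (const V z (name_of V (Pr V X n i))) h = f i)"
    have a: "?a \<in> Obj V" "Pw V X n \<in> Obj V" using X by auto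
    have nm: "const V z (name_of V (Pr V X n i)) \<in> hom V z (Exp V (Pw V X n) X)" if "i < n" for i
      using X z that by auto
    define F where "F i = Ev V ?a X \<cdot> \<langle>f i \<cdot> Fst V z ?a, Snd V z ?a\<rangle>" for i
    have F: "F i \<in> hom V (z \<otimes> ?a) X" if "i < n" for i
      unfolding F_def by (rule comp_hom[OF pair_hom ev_hom]) (use z a X f[OF that] in blast)+
    define h where "h = curry V z ?a (tuple V (z \<otimes> ?a) X n F)"
    have h: "h \<in> hom V z (Exp V ?a (Pw V X n))"
      unfolding h_def by (rule curry_tuple_hom) (use z a X F in auto)
    have "?P h"
    proof (intro conjI allI impI)
      show "h \<in> hom V z (Exp V ?a (Pw V X n))" by (rule h)
      fix i assume i: "i < n"
      show "vcomp V (self_vcat V) ?a (Pw V X n) X (const V z (name_of V (Pr V X n i))) h = f i"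
      proof (rule exp_ext[OF self_vcomp_hom[OF nm[OF i] h a X] f[OF i] a(1) X])
        fix w s x assume s: "s \<in> hom V w z" and x: "x \<in> hom V w ?a"
        have "Pr V X n i \<cdot> app ?a (Pw V X n) (h \<cdot> s) x = F i \<cdot> \<langle>s, x\<rangle>"
          unfolding h_def by (rule pr_app_curry_tuple) (use z a X F s x i in auto)
        also have "\<dots> = app ?a X (f i \<cdot> s) x"
          unfolding F_def by (rule ev_shift[OF f[OF i] s x X])
        finally show "app ?a X (vcomp V (self_vcat V) ?a (Pw V X n) X (const V z (name_of V (Pr V X n i))) h \<cdot> s) x
          = app ?a X (f i \<cdot> s) x"
          unfolding app_full_Proj[OF X i h s x] .
      qed
    qed
    moreover have "k = h" if "?P k" for k
    proof (rule exp_ext[OF _ h a])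
      show k: "k \<in> hom V z (Exp V ?a (Pw V X n))" using that by blast
      fix w s x assume s: "s \<in> hom V w z" and x: "x \<in> hom V w ?a"
      have ks: "k \<cdot> s \<in> hom V w (Exp V ?a (Pw V X n))" "h \<cdot> s \<in> hom V w (Exp V ?a (Pw V X n))"
        using k h s by blast+
      show "app ?a (Pw V X n) (k \<cdot> s) x = app ?a (Pw V X n) (h \<cdot> s) x"
      proof (rule tuple_eqI[OF app_hom[OF ks(1) x a(2)] app_hom[OF ks(2) x a(2)] X])
        fix i assume i: "i < n"
        have "vcomp V (self_vcat V) ?a (Pw V X n) X (const V z (name_of V (Pr V X n i))) k
          = vcomp V (self_vcat V) ?a (Pw V X n) X (const V z (name_of V (Pr V X n i))) h"
          using that \<open>?P h\<close> i by simp
        then show "Pr V X n i \<cdot> app ?a (Pw V X n) (k \<cdot> s) x = Pr V X n i \<cdot> app ?a (Pw V X n) (h \<cdot> s) x"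
          using app_full_Proj[OF X i k s x] app_full_Proj[OF X i h s x] by simp
      qed
    qed
    ultimately show "\<exists>!h. ?P h" by blast
  qed (simp_all add: full_sel)
qed

lemma id_theory_morphism:
  assumes T: "is_theory V T"
  shows "is_theory_morphism V T T (\<lambda>n m. Ide V (VHom T n m))"
proof -
  have C: "is_vcategory V T" and U: "VObj T = UNIV" using T by (auto simp: is_theory_def)
  have idl: "Ide V b \<cdot> f = f" if "f \<in> hom V a b" for f a b using ide_left[OF that] .
  have VH: "VHom T n m \<in> Obj V" and VI: "VId T n \<in> hom V (One V) (VHom T n n)"
    and VC: "VComp T n m k \<in> hom V (VHom T m k \<otimes> VHom T n m) (VHom T n k)" for n m k
    using C U by (simp_all add: vcat_hom_obj vcat_VId vcat_VComp)
  have VP: "Proj T n i \<in> hom V (One V) (VHom T n 1)" if "i < n" for n i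
    using T that by (auto simp: is_theory_def exhibits_power_def)
  show ?thesis
    unfolding is_theory_morphism_def is_vfunctor_def
  proof (intro conjI ballI allI impI)
    fix a b c z f g assume "f \<in> hom V z (VHom T a b)" "g \<in> hom V z (VHom T b c)"
    then show "Ide V (VHom T a c) \<cdot> vcomp V T a b c g f =
       vcomp V T (id a) (id b) (id c) (Ide V (VHom T b c) \<cdot> g) (Ide V (VHom T a b) \<cdot> f)"
      using idl[OF vcomp_hom[OF VC]] idl by (simp add: id_def)
  qed (use C U T VH idl[OF VI] idl[OF VP] in auto)
qed

lemma iso_over_refl:
  assumes "is_theory_over V X T A"
  shows "iso_over V X T A T A"
proof -
  have T: "is_theory V T" and F: "\<And>n m. A n m \<in> hom V (VHom T n m) (VHom (full_theory V X) n m)"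
    using assms by (auto simp: is_theory_over_def is_theory_morphism_def is_vfunctor_def is_theory_def)
  have H: "VHom T n m \<in> Obj V" for n m
    using T by (auto simp: is_theory_def is_vcategory_def)
  show ?thesis
    unfolding iso_over_def
  proof (intro conjI assms exI allI)
    show "is_theory_morphism V T T (\<lambda>n m. Ide V (VHom T n m))"
      "is_theory_morphism V T T (\<lambda>n m. Ide V (VHom T n m))"
      using id_theory_morphism[OF T] by auto
    fix n m
    show "A n m \<cdot> Ide V (VHom T n m) = A n m" "A n m \<cdot> Ide V (VHom T n m) = A n m"
      using ide_right[OF F] by auto
    show "Ide V (VHom T n m) \<cdot> Ide V (VHom T n m) = Ide V (VHom T n m)"
      "Ide V (VHom T n m) \<cdot> Ide V (VHom T n m) = Ide V (VHom T n m)"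
      using ide_right[OF ide_hom[OF H]] by auto
  qed
qed

section \<open>Natural families\<close>

text \<open>Naturality, like equality, may be tested on values. The converse below applies both sides of the
  naturality square to an element.\<close>

lemma natural_familyI:
  assumes z: "z \<in> Obj V"
    and Fo: "\<And>a. a \<in> VObj C \<Longrightarrow> Fo a \<in> Obj V" and Go: "\<And>a. a \<in> VObj C \<Longrightarrow> Go a \<in> Obj V"
    and p: "\<And>a. a \<in> VObj C \<Longrightarrow> p a \<in> hom V z (Exp V (Fo a) (Go a))"
    and Fm: "\<And>a b. \<lbrakk>a \<in> VObj C; b \<in> VObj C\<rbrakk> \<Longrightarrow> Fm a b \<in> hom V (VHom C a b) (Exp V (Fo a) (Fo b))"
    and Gm: "\<And>a b. \<lbrakk>a \<in> VObj C; b \<in> VObj C\<rbrakk> \<Longrightarrow> Gm a b \<in> hom V (VHom C a b) (Exp V (Go a) (Go b))"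
    and nat: "\<And>a b w s t x. \<lbrakk>a \<in> VObj C; b \<in> VObj C; s \<in> hom V w z; t \<in> hom V w (VHom C a b); x \<in> hom V w (Fo a)\<rbrakk>
       \<Longrightarrow> app (Fo b) (Go b) (p b \<cdot> s) (app (Fo a) (Fo b) (Fm a b \<cdot> t) x)
         = app (Go a) (Go b) (Gm a b \<cdot> t) (app (Fo a) (Go a) (p a \<cdot> s) x)"
  shows "is_natural_family V C Fo Fm Go Gm z p"
  unfolding is_natural_family_def
proof (intro conjI ballI allI)
  fix a b w s t
  assume a: "a \<in> VObj C" and b: "b \<in> VObj C" and s: "s \<in> hom V w z" and t: "t \<in> hom V w (VHom C a b)"
  note o = Fo[OF a] Fo[OF b] Go[OF b] Go[OF a]
  have ps: "p b \<cdot> s \<in> hom V w (Exp V (Fo b) (Go b))" "p a \<cdot> s \<in> hom V w (Exp V (Fo a) (Go a))"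
    using p a b s by blast+
  have Ft: "Fm a b \<cdot> t \<in> hom V w (Exp V (Fo a) (Fo b))" and Gt: "Gm a b \<cdot> t \<in> hom V w (Exp V (Go a) (Go b))"
    using Fm Gm a b t by blast+
  show "vcomp V (self_vcat V) (Fo a) (Fo b) (Go b) (p b \<cdot> s) (Fm a b \<cdot> t)
    = vcomp V (self_vcat V) (Fo a) (Go a) (Go b) (Gm a b \<cdot> t) (p a \<cdot> s)"
  proof (rule self_vcomp_eqI[OF ps(1) Ft self_vcomp_hom[OF Gt ps(2) o(1,4,3)] o(1-3)])
    fix v r x assume r: "r \<in> hom V v w" and x: "x \<in> hom V v (Fo a)"
    show "app (Fo b) (Go b) ((p b \<cdot> s) \<cdot> r) (app (Fo a) (Fo b) ((Fm a b \<cdot> t) \<cdot> r) x)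
      = app (Fo a) (Go b) (vcomp V (self_vcat V) (Fo a) (Go a) (Go b) (Gm a b \<cdot> t) (p a \<cdot> s) \<cdot> r) x"
      unfolding self_vcomp_comp[OF Gt ps(2) o(1,4,3) r]
        app_self_VComp[OF o(1,4,3) comp_hom[OF r Gt] comp_hom[OF r ps(2)] x]
      using nat[OF a b comp_hom[OF r s] comp_hom[OF r t] x]
      unfolding comp_assoc[OF r s p[OF a]] comp_assoc[OF r s p[OF b]]
        comp_assoc[OF r t Fm[OF a b]] comp_assoc[OF r t Gm[OF a b]] .
  qed
qed (use z p in auto)

lemma natural_familyD:
  assumes N: "is_natural_family V C Fo Fm Go Gm z p"
    and Fm: "Fm a b \<in> hom V (VHom C a b) (Exp V (Fo a) (Fo b))"
    and Gm: "Gm a b \<in> hom V (VHom C a b) (Exp V (Go a) (Go b))"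
    and a: "a \<in> VObj C" and b: "b \<in> VObj C"
    and o: "Fo a \<in> Obj V" "Fo b \<in> Obj V" "Go a \<in> Obj V" "Go b \<in> Obj V"
    and s: "s \<in> hom V w z" and t: "t \<in> hom V w (VHom C a b)" and x: "x \<in> hom V w (Fo a)"
  shows "app (Fo b) (Go b) (p b \<cdot> s) (app (Fo a) (Fo b) (Fm a b \<cdot> t) x)
         = app (Go a) (Go b) (Gm a b \<cdot> t) (app (Fo a) (Go a) (p a \<cdot> s) x)"
proof -
  have "p a \<in> hom V z (Exp V (Fo a) (Go a))" "p b \<in> hom V z (Exp V (Fo b) (Go b))"
    using N a b by (auto simp: is_natural_family_def)
  then have ps: "p a \<cdot> s \<in> hom V w (Exp V (Fo a) (Go a))" "p b \<cdot> s \<in> hom V w (Exp V (Fo b) (Go b))"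
    using s by blast+
  have "vcomp V (self_vcat V) (Fo a) (Fo b) (Go b) (p b \<cdot> s) (Fm a b \<cdot> t)
    = vcomp V (self_vcat V) (Fo a) (Go a) (Go b) (Gm a b \<cdot> t) (p a \<cdot> s)"
    using N a b s t by (simp add: is_natural_family_def)
  then show ?thesis
    using app_self_VComp[OF o(1,2,4) ps(2) comp_hom[OF t Fm] x]
      app_self_VComp[OF o(1,3,4) comp_hom[OF t Gm] ps(1) x] by simp
qed

section \<open>Hom functors as algebras\<close>

text \<open>The action on morphisms of the hom functor \<open>VHom T k\<close> into the base category.\<close>

definition postcomp :: "('o, 'm) thy \<Rightarrow> nat \<Rightarrow> nat \<Rightarrow> nat \<Rightarrow> 'm" where
  "postcomp T k n m = curry V (VHom T n m) (VHom T k n) (VComp T k n m)"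

lemma postcomp_hom:
  assumes "is_vcategory V T" "VObj T = UNIV"
  shows "postcomp T k n m \<in> hom V (VHom T n m) (Exp V (VHom T k n) (VHom T k m))"
  unfolding postcomp_def by (rule curry_hom) (use assms in \<open>simp_all add: vcat_hom_obj vcat_VComp\<close>)

lemma app_postcomp:
  assumes "is_vcategory V T" "VObj T = UNIV"
    and "a \<in> hom V w (VHom T n m)" "x \<in> hom V w (VHom T k n)"
  shows "app (VHom T k n) (VHom T k m) (postcomp T k n m \<cdot> a) x = vcomp V T k n m a x"
  unfolding postcomp_def vcomp_def by (rule app_curry) (use assms in \<open>simp_all add: vcat_VComp\<close>)

text \<open>A hom functor preserves all powers that exist, hence is an algebra; if its values are the chosen
  powers of \<open>X\<close> and its action on the designated projections is given by the chosen projections,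
  then it is a morphism into the full theory of \<open>X\<close>. Functoriality is the associativity of
  composition in \<open>T\<close>.\<close>

lemma postcomp_theory_morphism:
  assumes T: "is_theory V T" and X: "X \<in> Obj V"
    and H: "\<And>n. VHom T k n = Pw V X n"
    and P: "\<And>n i z x. \<lbrakk>i < n; x \<in> hom V z (Pw V X n)\<rbrakk>
      \<Longrightarrow> vcomp V T k n 1 (const V z (Proj T n i)) x = Pr V X n i \<cdot> x"
  shows "is_theory_morphism V T (full_theory V X) (postcomp T k)"
proof -
  have C: "is_vcategory V T" and U: "VObj T = UNIV" using T by (auto simp: is_theory_def)
  have VH: "VHom T n m \<in> Obj V" and VI: "VId T n \<in> hom V (One V) (VHom T n n)"
    and VC: "VComp T n m k \<in> hom V (VHom T m k \<otimes> VHom T n m) (VHom T n k)" for n m k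
    using C U by (simp_all add: vcat_hom_obj vcat_VId vcat_VComp)
  have VP: "Proj T n i \<in> hom V (One V) (VHom T n 1)" if "i < n" for n i
    using T that by (auto simp: is_theory_def exhibits_power_def)
  note rh = postcomp_hom[OF C U, where k = k, unfolded H]
  note ar = app_postcomp[OF C U, where k = k, unfolded H]
  have X': "Pw V X n \<in> Obj V" for n using X by auto
  \<comment> \<open>Identities and projections are points, and a point of an exponential is named by an arrow.\<close>
  have point: "postcomp T k n m \<cdot> e = name_of V f"
    if e: "e \<in> hom V (One V) (VHom T n m)" and f: "f \<in> hom V (Pw V X n) (Pw V X m)"
    and eq: "\<And>w x. x \<in> hom V w (Pw V X n) \<Longrightarrow> vcomp V T k n m (const V w e) x = f \<cdot> x" for n m e f
  proof (rule exp_ext)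
    show re: "postcomp T k n m \<cdot> e \<in> hom V (One V) (Exp V (Pw V X n) (Pw V X m))" using e rh by blast
    show nf: "name_of V f \<in> hom V (One V) (Exp V (Pw V X n) (Pw V X m))" using f by auto
    fix w s x assume w: "w \<in> Obj V" and s: "s \<in> hom V w (One V)" and x: "x \<in> hom V w (Pw V X n)"
    have es: "c \<cdot> s = const V w c" if "c \<in> hom V (One V) b" for c b
      using const_comp[OF that s] const_One[OF that] by simp
    have "app (Pw V X n) (Pw V X m) ((postcomp T k n m \<cdot> e) \<cdot> s) x
      = app (Pw V X n) (Pw V X m) (postcomp T k n m \<cdot> const V w e) x"
      using comp_assoc[OF s e rh] es[OF e] by simp
    also have "\<dots> = vcomp V T k n m (const V w e) x"
      by (rule ar[OF const_hom[OF w e] x])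
    also have "\<dots> = app (Pw V X n) (Pw V X m) (name_of V f \<cdot> s) x"
      using eq[OF x] app_name_of[OF f x] es[OF nf] by simp
    finally show "app (Pw V X n) (Pw V X m) ((postcomp T k n m \<cdot> e) \<cdot> s) x
      = app (Pw V X n) (Pw V X m) (name_of V f \<cdot> s) x" .
  qed (use X' in auto)
  show ?thesis
    unfolding is_theory_morphism_def is_vfunctor_def id_def full_sel
  proof (intro conjI ballI allI impI)
    fix n show "postcomp T k n n \<cdot> VId T n = name_of V (Ide V (Pw V X n))"
    proof (rule point[OF VI])
      fix w x assume x: "x \<in> hom V w (Pw V X n)"
      show "vcomp V T k n n (const V w (VId T n)) x = Ide V (Pw V X n) \<cdot> x"
        unfolding ide_left[OF x] by (rule vcat_left_id[OF C]) (use U H x in auto)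
    qed (use X' in auto)
  next
    fix n i :: nat assume i: "i < n"
    show "postcomp T k n 1 \<cdot> Proj T n i = name_of V (Pr V X n i)"
    proof (rule point[OF VP[OF i]])
      show "Pr V X n i \<in> hom V (Pw V X n) (Pw V X 1)" using pr_hom[OF X i] pw_1[OF X] by simp
    qed (rule P[OF i])
  next
    fix a b c z f g
    assume f: "f \<in> hom V z (VHom T a b)" and g: "g \<in> hom V z (VHom T b c)"
    let ?P = "Pw V X"
    have gf: "vcomp V T a b c g f \<in> hom V z (VHom T a c)" by (rule vcomp_hom[OF VC f g])
    have R: "postcomp T k a b \<cdot> f \<in> hom V z (Exp V (?P a) (?P b))"
      "postcomp T k b c \<cdot> g \<in> hom V z (Exp V (?P b) (?P c))"
      "postcomp T k a c \<cdot> vcomp V T a b c g f \<in> hom V z (Exp V (?P a) (?P c))"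
      using f g gf rh by blast+
    have "vcomp V (self_vcat V) (?P a) (?P b) (?P c) (postcomp T k b c \<cdot> g) (postcomp T k a b \<cdot> f)
      = postcomp T k a c \<cdot> vcomp V T a b c g f"
    proof (rule self_vcomp_eqI[OF R(2,1,3) X' X' X'])
      fix w s x assume s: "s \<in> hom V w z" and x: "x \<in> hom V w (?P a)"
      have fs: "f \<cdot> s \<in> hom V w (VHom T a b)" and gs: "g \<cdot> s \<in> hom V w (VHom T b c)"
        using f g s by blast+
      have gfs: "vcomp V T a b c g f \<cdot> s = vcomp V T a b c (g \<cdot> s) (f \<cdot> s)"
        by (rule vcomp_comp[OF VC f g s])
      have fx: "vcomp V T k a b (f \<cdot> s) x \<in> hom V w (?P b)"
        using vcomp_hom[OF VC _ fs, of x k] x H by simp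
      have "app (?P b) (?P c) ((postcomp T k b c \<cdot> g) \<cdot> s) (app (?P a) (?P b) ((postcomp T k a b \<cdot> f) \<cdot> s) x)
        = vcomp V T k b c (g \<cdot> s) (vcomp V T k a b (f \<cdot> s) x)"
        unfolding comp_assoc[OF s f rh, symmetric] comp_assoc[OF s g rh, symmetric]
          ar[OF fs x] ar[OF gs fx] ..
      also have "\<dots> = vcomp V T k a c (vcomp V T a b c (g \<cdot> s) (f \<cdot> s)) x"
        by (rule vcat_assoc[OF C _ _ _ _ _ fs gs]) (use U H x in auto)
      also have "\<dots> = app (?P a) (?P c) ((postcomp T k a c \<cdot> vcomp V T a b c g f) \<cdot> s) x"
        unfolding comp_assoc[OF s gf rh, symmetric] gfs
        by (rule ar[OF vcomp_hom[OF VC fs gs] x, symmetric])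
      finally show "app (?P b) (?P c) ((postcomp T k b c \<cdot> g) \<cdot> s) (app (?P a) (?P b) ((postcomp T k a b \<cdot> f) \<cdot> s) x)
        = app (?P a) (?P c) ((postcomp T k a c \<cdot> vcomp V T a b c g f) \<cdot> s) x" .
    qed
    then show "postcomp T k a c \<cdot> vcomp V T a b c g f =
       vcomp V (self_vcat V) (?P a) (?P b) (?P c) (postcomp T k b c \<cdot> g) (postcomp T k a b \<cdot> f)" ..
  qed (use T U C X rh full_is_theory full_is_vcategory in auto)
qed

end

section \<open>Rigs and finite sums\<close>

locale rig_elements = ccc_elements V
  for V :: "('o, 'm) ccc" (structure) +
  fixes R :: "('o, 'm) rig"
  assumes rig: "is_rig V R"
begin

abbreviation plus (infixl "\<oplus>" 65) where "x \<oplus> y \<equiv> radd V R x y"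
abbreviation times (infixl "\<odot>" 70) where "x \<odot> y \<equiv> rmul V R x y"
abbreviation zer where "zer z \<equiv> const V z (Zer R)"

text \<open>The Kronecker delta at stage \<open>z\<close>: the identity matrices, the designated projections and the
  unit columns below all have these entries.\<close>

abbreviation kron where "kron z j i \<equiv> const V z (if j = i then Uni R else Zer R)"

lemma car_obj [intro]: "Car R \<in> Obj V"
  and add_arr: "Add R \<in> hom V (Car R \<otimes> Car R) (Car R)"
  and zer_arr [intro]: "Zer R \<in> hom V (One V) (Car R)"
  and mul_arr: "Mul R \<in> hom V (Car R \<otimes> Car R) (Car R)"
  and uni_arr [intro]: "Uni R \<in> hom V (One V) (Car R)"
  using rig unfolding is_rig_def by auto

lemma radd_hom [intro]: "\<lbrakk>x \<in> hom V z (Car R); y \<in> hom V z (Car R)\<rbrakk> \<Longrightarrow> x \<oplus> y \<in> hom V z (Car R)"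
  and rmul_hom [intro]: "\<lbrakk>x \<in> hom V z (Car R); y \<in> hom V z (Car R)\<rbrakk> \<Longrightarrow> x \<odot> y \<in> hom V z (Car R)"
  unfolding radd_def rmul_def using add_arr mul_arr by blast+

lemma radd_comp:
    "\<lbrakk>x \<in> hom V z (Car R); y \<in> hom V z (Car R); s \<in> hom V w z\<rbrakk> \<Longrightarrow> (x \<oplus> y) \<cdot> s = x \<cdot> s \<oplus> y \<cdot> s"
  and rmul_comp:
    "\<lbrakk>x \<in> hom V z (Car R); y \<in> hom V z (Car R); s \<in> hom V w z\<rbrakk> \<Longrightarrow> (x \<odot> y) \<cdot> s = (x \<cdot> s) \<odot> (y \<cdot> s)"
  unfolding radd_def rmul_def
  using comp_assoc[OF _ pair_hom add_arr] comp_assoc[OF _ pair_hom mul_arr] by (simp_all add: pair_comp)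

lemma rig_laws:
  assumes "x \<in> hom V z (Car R)" "y \<in> hom V z (Car R)" "w \<in> hom V z (Car R)"
  shows radd_assoc: "(x \<oplus> y) \<oplus> w = x \<oplus> (y \<oplus> w)"
    and rmul_assoc: "(x \<odot> y) \<odot> w = x \<odot> (y \<odot> w)"
    and rmul_radd: "x \<odot> (y \<oplus> w) = x \<odot> y \<oplus> x \<odot> w"
    and radd_rmul: "(x \<oplus> y) \<odot> w = x \<odot> w \<oplus> y \<odot> w"
  using assms rig hom_obj(1)[OF assms(1)] unfolding is_rig_def by blast+

lemma radd_commute:
  assumes "x \<in> hom V z (Car R)" "y \<in> hom V z (Car R)"
  shows "x \<oplus> y = y \<oplus> x"
  using assms rig hom_obj(1)[OF assms(1)] unfolding is_rig_def by blast

lemma rig_unit_laws: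
  assumes "x \<in> hom V z (Car R)"
  shows zer_radd: "zer z \<oplus> x = x"
    and uni_rmul: "const V z (Uni R) \<odot> x = x"
    and rmul_uni: "x \<odot> const V z (Uni R) = x"
    and rmul_zer: "x \<odot> zer z = zer z"
    and zer_rmul: "zer z \<odot> x = zer z"
  using assms rig hom_obj(1)[OF assms(1)] unfolding is_rig_def by auto

lemma radd_zer:
  assumes x: "x \<in> hom V z (Car R)"
  shows "x \<oplus> zer z = x"
proof -
  have "zer z \<in> hom V z (Car R)" using hom_obj(1)[OF x] by blast
  then show ?thesis using radd_commute[OF x] zer_radd[OF x] by simp
qed

lemma radd_swap:
  assumes "a \<in> hom V z (Car R)" "b \<in> hom V z (Car R)" "c \<in> hom V z (Car R)" "d \<in> hom V z (Car R)"
  shows "(a \<oplus> b) \<oplus> (c \<oplus> d) = (a \<oplus> c) \<oplus> (b \<oplus> d)"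
proof -
  have "(a \<oplus> b) \<oplus> (c \<oplus> d) = a \<oplus> ((b \<oplus> c) \<oplus> d)"
    using radd_assoc[OF assms(1,2) radd_hom[OF assms(3,4)]] radd_assoc[OF assms(2,3,4)] by simp
  also have "b \<oplus> c = c \<oplus> b" by (rule radd_commute[OF assms(2,3)])
  also have "a \<oplus> ((c \<oplus> b) \<oplus> d) = (a \<oplus> c) \<oplus> (b \<oplus> d)"
    using radd_assoc[OF assms(1,3) radd_hom[OF assms(2,4)]] radd_assoc[OF assms(3,2,4)] by simp
  finally show ?thesis .
qed

lemma rsum_hom [intro]:
  "\<lbrakk>z \<in> Obj V; \<And>i. i < n \<Longrightarrow> f i \<in> hom V z (Car R)\<rbrakk> \<Longrightarrow> rsum V R z f n \<in> hom V z (Car R)"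
  by (induction n) auto

lemma rsum_cong: "(\<And>i. i < n \<Longrightarrow> f i = g i) \<Longrightarrow> rsum V R z f n = rsum V R z g n"
  by (induction n) auto

lemma rsum_comp:
  assumes s: "s \<in> hom V w z"
  shows "(\<And>i. i < n \<Longrightarrow> f i \<in> hom V z (Car R)) \<Longrightarrow> rsum V R z f n \<cdot> s = rsum V R w (\<lambda>i. f i \<cdot> s) n"
proof (induction n)
  case 0
  then show ?case using const_comp[OF zer_arr s] by simp
next
  case (Suc n)
  have "rsum V R z f n \<in> hom V z (Car R)" by (rule rsum_hom) (use hom_obj(2)[OF s] Suc.prems in auto)
  then show ?case using Suc radd_comp[OF _ Suc.prems s] by simp
qed

lemma rsum_radd:
  assumes "z \<in> Obj V"
  shows "(\<And>i. i < n \<Longrightarrow> f i \<in> hom V z (Car R) \<and> g i \<in> hom V z (Car R)) \<Longrightarrow>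
    rsum V R z (\<lambda>i. f i \<oplus> g i) n = rsum V R z f n \<oplus> rsum V R z g n"
proof (induction n)
  case 0
  have "zer z \<in> hom V z (Car R)" using assms by auto
  then show ?case using zer_radd by simp
next
  case (Suc n)
  have "rsum V R z f n \<in> hom V z (Car R)" "rsum V R z g n \<in> hom V z (Car R)"
    by (rule rsum_hom; use assms Suc.prems in simp)+
  then show ?case using Suc radd_swap by simp
qed

lemma rsum_zer:
  assumes "z \<in> Obj V"
  shows "(\<And>i. i < n \<Longrightarrow> f i = zer z) \<Longrightarrow> rsum V R z f n = zer z"
proof (induction n)
  case (Suc n)
  have "zer z \<in> hom V z (Car R)" using assms by auto
  then show ?case using Suc zer_radd by simp
qed simp

lemma rmul_rsum:
  assumes a: "a \<in> hom V z (Car R)"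
  shows "(\<And>i. i < n \<Longrightarrow> f i \<in> hom V z (Car R)) \<Longrightarrow>
    a \<odot> rsum V R z f n = rsum V R z (\<lambda>i. a \<odot> f i) n"
proof (induction n)
  case 0
  then show ?case using rmul_zer[OF a] by simp
next
  case (Suc n)
  have "rsum V R z f n \<in> hom V z (Car R)" by (rule rsum_hom) (use hom_obj(1)[OF a] Suc.prems in auto)
  then show ?case using Suc rmul_radd[OF a] by simp
qed

lemma rsum_rmul:
  assumes a: "a \<in> hom V z (Car R)"
  shows "(\<And>i. i < n \<Longrightarrow> f i \<in> hom V z (Car R)) \<Longrightarrow>
    rsum V R z f n \<odot> a = rsum V R z (\<lambda>i. f i \<odot> a) n"
proof (induction n)
  case 0
  then show ?case using zer_rmul[OF a] by simp
next
  case (Suc n)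
  have "rsum V R z f n \<in> hom V z (Car R)" by (rule rsum_hom) (use hom_obj(1)[OF a] Suc.prems in auto)
  then show ?case using Suc radd_rmul[OF _ _ a] by simp
qed

lemma rsum_swap:
  assumes z: "z \<in> Obj V"
  shows "(\<And>i j. \<lbrakk>i < n; j < m\<rbrakk> \<Longrightarrow> f i j \<in> hom V z (Car R)) \<Longrightarrow>
    rsum V R z (\<lambda>i. rsum V R z (f i) m) n = rsum V R z (\<lambda>j. rsum V R z (\<lambda>i. f i j) n) m"
proof (induction n)
  case 0
  then show ?case using rsum_zer[OF z] by simp
next
  case (Suc n)
  have "rsum V R z (\<lambda>j. rsum V R z (\<lambda>i. f i j) n \<oplus> f n j) m =
    rsum V R z (\<lambda>j. rsum V R z (\<lambda>i. f i j) n) m \<oplus> rsum V R z (f n) m"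
    by (rule rsum_radd[OF z]) (use Suc.prems z in \<open>auto intro!: rsum_hom\<close>)
  then show ?case using Suc by simp
qed

lemma rsum_single:
  assumes z: "z \<in> Obj V" and g: "g k \<in> hom V z (Car R)"
  shows "\<lbrakk>k < n; \<And>j. \<lbrakk>j < n; j \<noteq> k\<rbrakk> \<Longrightarrow> g j = zer z\<rbrakk> \<Longrightarrow> rsum V R z g n = g k"
proof (induction n)
  case (Suc n)
  show ?case
  proof (cases "k = n")
    case True
    then have "rsum V R z g n = zer z" using rsum_zer[OF z] Suc.prems by simp
    then show ?thesis using True zer_radd[OF g] by simp
  next
    case False
    then have "rsum V R z g n = g k" "g n = zer z" using Suc by auto
    then show ?thesis using radd_zer[OF g] by simp
  qed
qed simp

lemma rsum_kron_left:
  assumes z: "z \<in> Obj V" and f: "\<And>j. j < n \<Longrightarrow> f j \<in> hom V z (Car R)" and k: "k < n"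
  shows "rsum V R z (\<lambda>j. kron z k j \<odot> f j) n = f k"
proof -
  have "rsum V R z (\<lambda>j. kron z k j \<odot> f j) n = kron z k k \<odot> f k"
    by (rule rsum_single) (use z f[OF k] k zer_rmul[OF f] in \<open>auto intro!: rmul_hom\<close>)
  then show ?thesis using uni_rmul[OF f[OF k]] by simp
qed

lemma rsum_kron_right:
  assumes z: "z \<in> Obj V" and f: "\<And>j. j < n \<Longrightarrow> f j \<in> hom V z (Car R)" and k: "k < n"
  shows "rsum V R z (\<lambda>j. f j \<odot> kron z j k) n = f k"
proof -
  have "rsum V R z (\<lambda>j. f j \<odot> kron z j k) n = f k \<odot> kron z k k"
    by (rule rsum_single) (use z f[OF k] k rmul_zer[OF f] in \<open>auto intro!: rmul_hom\<close>)
  then show ?thesis using rmul_uni[OF f[OF k]] by simp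
qed

lemma kron_arr [intro]: "(if j = i then Uni R else Zer R) \<in> hom V (One V) (Car R)"
  using zer_arr uni_arr by simp

section \<open>The theory of matrices\<close>

lemma mat_objs [intro]: "mat_obj V R n m \<in> Obj V" "Pw V (Car R) n \<in> Obj V"
  unfolding mat_obj_def by auto

lemma entry_hom [intro]:
  "\<lbrakk>a \<in> hom V z (mat_obj V R n m); j < m; i < n\<rbrakk> \<Longrightarrow> entry V R n m a j i \<in> hom V z (Car R)"
  unfolding entry_def mat_obj_def by (meson car_obj comp_hom pr_hom pw_obj)

lemma matrix_hom [intro]:
  "\<lbrakk>z \<in> Obj V; \<And>j i. \<lbrakk>j < m; i < n\<rbrakk> \<Longrightarrow> f j i \<in> hom V z (Car R)\<rbrakk>
    \<Longrightarrow> matrix V R z n m f \<in> hom V z (mat_obj V R n m)"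
  unfolding matrix_def mat_obj_def by (auto intro!: tuple_hom)

lemma entry_matrix:
  assumes z: "z \<in> Obj V" and f: "\<And>j i. \<lbrakk>j < m; i < n\<rbrakk> \<Longrightarrow> f j i \<in> hom V z (Car R)"
    and ji: "j < m" "i < n"
  shows "entry V R n m (matrix V R z n m f) j i = f j i"
proof -
  have "Pr V (Pw V (Car R) n) m j \<cdot> matrix V R z n m f = tuple V z (Car R) n (f j)"
    unfolding matrix_def by (rule pr_tuple) (use z f ji in auto)
  moreover have "Pr V (Car R) n i \<cdot> tuple V z (Car R) n (f j) = f j i"
    by (rule pr_tuple) (use z f ji in auto)
  ultimately show ?thesis unfolding entry_def by simp
qed

text \<open>Matrices at a fixed stage are determined by their entries, so identities between matrices become
  identities in the rig of elements of \<open>Car R\<close> at that stage.\<close>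

lemma mat_eqI:
  assumes a: "a \<in> hom V z (mat_obj V R n m)" and b: "b \<in> hom V z (mat_obj V R n m)"
    and eq: "\<And>j i. \<lbrakk>j < m; i < n\<rbrakk> \<Longrightarrow> entry V R n m a j i = entry V R n m b j i"
  shows "a = b"
proof (rule tuple_eqI)
  show a': "a \<in> hom V z (Pw V (Pw V (Car R) n) m)" and b': "b \<in> hom V z (Pw V (Pw V (Car R) n) m)"
    using a b by (auto simp: mat_obj_def)
  show P: "Pw V (Car R) n \<in> Obj V" by auto
  fix j assume j: "j < m"
  show "Pr V (Pw V (Car R) n) m j \<cdot> a = Pr V (Pw V (Car R) n) m j \<cdot> b"
    by (rule tuple_eqI[OF comp_hom[OF a' pr_hom[OF P j]] comp_hom[OF b' pr_hom[OF P j]] car_obj])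
      (use eq[OF j] in \<open>simp add: entry_def\<close>)
qed

lemma entry_comp:
  assumes a: "a \<in> hom V z (mat_obj V R n m)" and s: "s \<in> hom V w z" and ji: "j < m" "i < n"
  shows "entry V R n m (a \<cdot> s) j i = entry V R n m a j i \<cdot> s"
proof -
  have P: "Pw V (Car R) n \<in> Obj V" by auto
  have a': "a \<in> hom V z (Pw V (Pw V (Car R) n) m)" using a by (simp add: mat_obj_def)
  show ?thesis
    unfolding entry_def comp_assoc[OF s a' pr_hom[OF P ji(1)]]
    by (rule comp_assoc[OF s _ pr_hom[OF car_obj ji(2)]]) (use a' pr_hom[OF P ji(1)] in blast)
qed

lemma matrix_comp:
  assumes s: "s \<in> hom V w z" and f: "\<And>j i. \<lbrakk>j < m; i < n\<rbrakk> \<Longrightarrow> f j i \<in> hom V z (Car R)"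
  shows "matrix V R z n m f \<cdot> s = matrix V R w n m (\<lambda>j i. f j i \<cdot> s)"
proof -
  have o: "z \<in> Obj V" "w \<in> Obj V" using s by auto
  have fs: "\<And>j i. \<lbrakk>j < m; i < n\<rbrakk> \<Longrightarrow> f j i \<cdot> s \<in> hom V w (Car R)" using f s by blast
  have 1: "matrix V R z n m f \<in> hom V z (mat_obj V R n m)" by (rule matrix_hom) (use o f in auto)
  have 2: "matrix V R w n m (\<lambda>j i. f j i \<cdot> s) \<in> hom V w (mat_obj V R n m)"
    by (rule matrix_hom) (use o fs in auto)
  show ?thesis
  proof (rule mat_eqI[OF comp_hom[OF s 1] 2])
    fix j i assume ji: "j < m" "i < n"
    have "entry V R n m (matrix V R z n m f) j i = f j i"
      by (rule entry_matrix) (use o f ji in auto)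
    moreover have "entry V R n m (matrix V R w n m (\<lambda>j i. f j i \<cdot> s)) j i = f j i \<cdot> s"
      by (rule entry_matrix) (use o fs ji in auto)
    ultimately show "entry V R n m (matrix V R z n m f \<cdot> s) j i
      = entry V R n m (matrix V R w n m (\<lambda>j i. f j i \<cdot> s)) j i"
      unfolding entry_comp[OF 1 s ji] by simp
  qed
qed

lemma Mat_sel:
  "VObj (Mat V R) = UNIV" "VHom (Mat V R) = mat_obj V R"
  "VId (Mat V R) n = matrix V R (One V) n n (\<lambda>j i. if j = i then Uni R else Zer R)"
  "Proj (Mat V R) n i = matrix V R (One V) n 1 (\<lambda>_ k. if k = i then Uni R else Zer R)"
  by (simp_all add: Mat_def)

abbreviation mmul where "mmul n m l b a \<equiv> vcomp V (Mat V R) n m l b a"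

text \<open>The composition morphism is built from the two generic matrices; substituting \<open>b\<close> and \<open>a\<close> for them
  gives the usual formula for the entries of a product.\<close>

lemma Mat_VComp: "VComp (Mat V R) n m l \<in> hom V (mat_obj V R m l \<otimes> mat_obj V R n m) (mat_obj V R n l)"
  and entry_mmul: "\<And>b a z k i. \<lbrakk>b \<in> hom V z (mat_obj V R m l); a \<in> hom V z (mat_obj V R n m); k < l; i < n\<rbrakk>
    \<Longrightarrow> entry V R n l (mmul n m l b a) k i
      = rsum V R z (\<lambda>j. entry V R m l b k j \<odot> entry V R n m a j i) m"
proof -
  define u where "u = mat_obj V R m l \<otimes> mat_obj V R n m"
  define B where "B = Fst V (mat_obj V R m l) (mat_obj V R n m)"
  define A where "A = Snd V (mat_obj V R m l) (mat_obj V R n m)"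
  define f where "f k i = rsum V R u (\<lambda>j. entry V R m l B k j \<odot> entry V R n m A j i) m" for k i
  have u: "u \<in> Obj V" unfolding u_def by auto
  have B: "B \<in> hom V u (mat_obj V R m l)" and A: "A \<in> hom V u (mat_obj V R n m)"
    unfolding u_def A_def B_def by auto
  have f: "f k i \<in> hom V u (Car R)" if "k < l" "i < n" for k i
    unfolding f_def by (rule rsum_hom) (use u A B that in auto)
  have VC: "VComp (Mat V R) n m l = matrix V R u n l f"
    by (simp add: Mat_def Let_def f_def[abs_def] u_def A_def B_def)
  show h: "VComp (Mat V R) n m l \<in> hom V (mat_obj V R m l \<otimes> mat_obj V R n m) (mat_obj V R n l)"
    unfolding VC u_def[symmetric] by (rule matrix_hom) (use u f in auto)
  fix b a z k i
  assume b: "b \<in> hom V z (mat_obj V R m l)" and a: "a \<in> hom V z (mat_obj V R n m)" and ki: "k < l" "i < n"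
  have s: "\<langle>b, a\<rangle> \<in> hom V z u" unfolding u_def using a b by auto
  have Bs: "B \<cdot> \<langle>b, a\<rangle> = b" and As: "A \<cdot> \<langle>b, a\<rangle> = a"
    unfolding A_def B_def using fst_pair[OF b a] snd_pair[OF b a] by auto
  have "entry V R n l (mmul n m l b a) k i = f k i \<cdot> \<langle>b, a\<rangle>"
    using entry_matrix[of u l n f] u f ki unfolding vcomp_def entry_comp[OF h[folded u_def] s ki] by (simp add: VC)
  also have "\<dots> = rsum V R z (\<lambda>j. (entry V R m l B k j \<odot> entry V R n m A j i) \<cdot> \<langle>b, a\<rangle>) m"
    unfolding f_def by (rule rsum_comp[OF s]) (use A B ki in auto)
  also have "\<dots> = rsum V R z (\<lambda>j. entry V R m l b k j \<odot> entry V R n m a j i) m"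
  proof (rule rsum_cong)
    fix j assume j: "j < m"
    show "(entry V R m l B k j \<odot> entry V R n m A j i) \<cdot> \<langle>b, a\<rangle> = entry V R m l b k j \<odot> entry V R n m a j i"
      using rmul_comp[OF entry_hom[OF B ki(1) j] entry_hom[OF A j ki(2)] s]
        entry_comp[OF B s ki(1) j] entry_comp[OF A s j ki(2)] Bs As by simp
  qed
  finally show "entry V R n l (mmul n m l b a) k i
      = rsum V R z (\<lambda>j. entry V R m l b k j \<odot> entry V R n m a j i) m" .
qed

lemma mmul_hom [intro]:
  "\<lbrakk>b \<in> hom V z (mat_obj V R m l); a \<in> hom V z (mat_obj V R n m)\<rbrakk> \<Longrightarrow> mmul n m l b a \<in> hom V z (mat_obj V R n l)"
  unfolding vcomp_def using Mat_VComp by blast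

lemma Mat_VId: "VId (Mat V R) n \<in> hom V (One V) (mat_obj V R n n)"
  and Mat_Proj: "Proj (Mat V R) n i \<in> hom V (One V) (mat_obj V R n 1)"
  unfolding Mat_sel by (rule matrix_hom; auto)+

lemma entry_const_matrix:
  assumes z: "z \<in> Obj V" and f: "\<And>j i. f j i \<in> hom V (One V) (Car R)" and ji: "j < m" "i < n"
  shows "entry V R n m (const V z (matrix V R (One V) n m f)) j i = const V z (f j i)"
proof -
  have M: "matrix V R (One V) n m f \<in> hom V (One V) (mat_obj V R n m)" by (rule matrix_hom) (use f in auto)
  show ?thesis
    unfolding const_def entry_comp[OF M bang_hom[OF z] ji]
    using entry_matrix[of "One V" m n f] one_obj f ji by simp
qed

lemma entry_VId: "\<lbrakk>z \<in> Obj V; j < n; i < n\<rbrakk> \<Longrightarrow> entry V R n n (const V z (VId (Mat V R) n)) j i = kron z j i"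
  and entry_Proj: "\<lbrakk>z \<in> Obj V; k < n\<rbrakk> \<Longrightarrow> entry V R n 1 (const V z (Proj (Mat V R) n i)) 0 k = kron z i k"
  unfolding Mat_sel by (subst entry_const_matrix; auto)+

lemma mmul_VId_left:
  assumes a: "a \<in> hom V z (mat_obj V R n m)"
  shows "mmul n m m (const V z (VId (Mat V R) m)) a = a"
proof -
  have z: "z \<in> Obj V" using a by auto
  have I: "const V z (VId (Mat V R) m) \<in> hom V z (mat_obj V R m m)" using Mat_VId z by auto
  show ?thesis
  proof (rule mat_eqI[OF mmul_hom[OF I a] a])
    fix j i assume ji: "j < m" "i < n"
    have "entry V R n m (mmul n m m (const V z (VId (Mat V R) m)) a) j i
      = rsum V R z (\<lambda>k. kron z j k \<odot> entry V R n m a k i) m"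
      unfolding entry_mmul[OF I a ji] by (rule rsum_cong) (simp add: entry_VId z ji)
    also have "\<dots> = entry V R n m a j i"
      by (rule rsum_kron_left) (use z a ji in auto)
    finally show "entry V R n m (mmul n m m (const V z (VId (Mat V R) m)) a) j i = entry V R n m a j i" .
  qed
qed

lemma mmul_VId_right:
  assumes a: "a \<in> hom V z (mat_obj V R n m)"
  shows "mmul n n m a (const V z (VId (Mat V R) n)) = a"
proof -
  have z: "z \<in> Obj V" using a by auto
  have I: "const V z (VId (Mat V R) n) \<in> hom V z (mat_obj V R n n)" using Mat_VId z by auto
  show ?thesis
  proof (rule mat_eqI[OF mmul_hom[OF a I] a])
    fix j i assume ji: "j < m" "i < n"
    have "entry V R n m (mmul n n m a (const V z (VId (Mat V R) n))) j i
      = rsum V R z (\<lambda>k. entry V R n m a j k \<odot> kron z k i) n"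
      unfolding entry_mmul[OF a I ji] by (rule rsum_cong) (simp add: entry_VId z ji)
    also have "\<dots> = entry V R n m a j i"
      by (rule rsum_kron_right) (use z a ji in auto)
    finally show "entry V R n m (mmul n n m a (const V z (VId (Mat V R) n))) j i = entry V R n m a j i" .
  qed
qed

lemma mmul_assoc:
  assumes a: "a \<in> hom V z (mat_obj V R n m)" and b: "b \<in> hom V z (mat_obj V R m l)"
    and c: "c \<in> hom V z (mat_obj V R l p)"
  shows "mmul n l p c (mmul n m l b a) = mmul n m p (mmul m l p c b) a"
proof (rule mat_eqI)
  have z: "z \<in> Obj V" using a by auto
  show ba: "mmul n l p c (mmul n m l b a) \<in> hom V z (mat_obj V R n p)"
    and "mmul n m p (mmul m l p c b) a \<in> hom V z (mat_obj V R n p)" using a b c by auto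
  fix j i assume ji: "j < p" "i < n"
  let ?a = "entry V R n m a" and ?b = "entry V R m l b" and ?c = "entry V R l p c"
  have ba: "mmul n m l b a \<in> hom V z (mat_obj V R n l)" and cb: "mmul m l p c b \<in> hom V z (mat_obj V R m p)"
    using a b c by auto
  have h: "?a k i \<in> hom V z (Car R)" "?b q k \<in> hom V z (Car R)" "?c j q \<in> hom V z (Car R)"
    if "k < m" "q < l" for k q
    using that ji a b c by auto
  have "entry V R n p (mmul n l p c (mmul n m l b a)) j i
    = rsum V R z (\<lambda>q. rsum V R z (\<lambda>k. ?c j q \<odot> (?b q k \<odot> ?a k i)) m) l"
    unfolding entry_mmul[OF c ba ji]
  proof (rule rsum_cong)
    fix q assume q: "q < l"
    show "?c j q \<odot> entry V R n l (mmul n m l b a) q i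
      = rsum V R z (\<lambda>k. ?c j q \<odot> (?b q k \<odot> ?a k i)) m"
      unfolding entry_mmul[OF b a q ji(2)] by (rule rmul_rsum) (use c q ji h in auto)
  qed
  also have "\<dots> = rsum V R z (\<lambda>k. rsum V R z (\<lambda>q. ?c j q \<odot> (?b q k \<odot> ?a k i)) l) m"
    by (rule rsum_swap[OF z]) (intro rmul_hom h)
  also have "\<dots> = entry V R n p (mmul n m p (mmul m l p c b) a) j i"
    unfolding entry_mmul[OF cb a ji]
  proof (rule rsum_cong)
    fix k assume k: "k < m"
    have "entry V R m p (mmul m l p c b) j k \<odot> ?a k i = rsum V R z (\<lambda>q. (?c j q \<odot> ?b q k) \<odot> ?a k i) l"
      unfolding entry_mmul[OF c b ji(1) k] by (rule rsum_rmul) (use a k ji h in auto)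
    also have "\<dots> = rsum V R z (\<lambda>q. ?c j q \<odot> (?b q k \<odot> ?a k i)) l"
      by (rule rsum_cong, rule rmul_assoc[OF h(3)[OF k] h(2)[OF k] h(1)[OF k]]) auto
    finally show "rsum V R z (\<lambda>q. ?c j q \<odot> (?b q k \<odot> ?a k i)) l
      = entry V R m p (mmul m l p c b) j k \<odot> ?a k i" ..
  qed
  finally show "entry V R n p (mmul n l p c (mmul n m l b a)) j i
    = entry V R n p (mmul n m p (mmul m l p c b) a) j i" .
qed

lemma Mat_is_vcategory: "is_vcategory V (Mat V R)"
  unfolding is_vcategory_def Mat_sel(1,2)
proof (intro conjI ballI)
  show "mat_obj V R a b \<in> Obj V" for a b by auto
  show "VId (Mat V R) a \<in> hom V (One V) (mat_obj V R a a)" for a by (rule Mat_VId)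
  show "VComp (Mat V R) a b c \<in> hom V (mat_obj V R b c \<otimes> mat_obj V R a b) (mat_obj V R a c)" for a b c
    by (rule Mat_VComp)
qed (rule mmul_VId_left mmul_VId_right mmul_assoc; assumption)+

lemma mmul_Proj:
  assumes a: "a \<in> hom V z (mat_obj V R k n)" and i: "i < n"
  shows "mmul k n 1 (const V z (Proj (Mat V R) n i)) a \<in> hom V z (mat_obj V R k 1)"
    and "\<And>l. l < k \<Longrightarrow> entry V R k 1 (mmul k n 1 (const V z (Proj (Mat V R) n i)) a) 0 l
       = entry V R k n a i l"
proof -
  have z: "z \<in> Obj V" using a by auto
  have P: "const V z (Proj (Mat V R) n i) \<in> hom V z (mat_obj V R n 1)" using Mat_Proj z by blast
  show "mmul k n 1 (const V z (Proj (Mat V R) n i)) a \<in> hom V z (mat_obj V R k 1)"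
    using P a by (rule mmul_hom)
  fix l assume l: "l < k"
  have "entry V R k 1 (mmul k n 1 (const V z (Proj (Mat V R) n i)) a) 0 l
    = rsum V R z (\<lambda>j. kron z i j \<odot> entry V R k n a j l) n"
    unfolding entry_mmul[OF P a zero_less_one l] by (rule rsum_cong) (use entry_Proj[OF z] in simp)
  also have "\<dots> = entry V R k n a i l" by (rule rsum_kron_left) (use z a i l in auto)
  finally show "entry V R k 1 (mmul k n 1 (const V z (Proj (Mat V R) n i)) a) 0 l
       = entry V R k n a i l" .
qed

text \<open>Multiplying by the \<open>i\<close>-th standard row vector extracts row \<open>i\<close>, so a tuple in this theory is
  the matrix with the prescribed rows.\<close>

lemma Mat_tupling:
  assumes z: "z \<in> Obj V" and f: "\<And>i. i < n \<Longrightarrow> f i \<in> hom V z (mat_obj V R k 1)"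
  shows "\<exists>!h. h \<in> hom V z (mat_obj V R k n) \<and>
    (\<forall>i<n. mmul k n 1 (const V z (Proj (Mat V R) n i)) h = f i)"
proof -
  have char: "(\<forall>i<n. mmul k n 1 (const V z (Proj (Mat V R) n i)) h = f i) \<longleftrightarrow>
      (\<forall>i<n. \<forall>l<k. entry V R k n h i l = entry V R k 1 (f i) 0 l)"
    if h: "h \<in> hom V z (mat_obj V R k n)" for h
  proof -
    have "mmul k n 1 (const V z (Proj (Mat V R) n i)) h = f i \<longleftrightarrow>
        (\<forall>l<k. entry V R k n h i l = entry V R k 1 (f i) 0 l)" if i: "i < n" for i
      using mmul_Proj[OF h i] mat_eqI[OF mmul_Proj(1)[OF h i] f[OF i]] by fastforce
    then show ?thesis by blast
  qed
  define h where "h = matrix V R z k n (\<lambda>i l. entry V R k 1 (f i) 0 l)"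
  have h: "h \<in> hom V z (mat_obj V R k n)" unfolding h_def by (rule matrix_hom) (use z f in auto)
  have e: "entry V R k n h i l = entry V R k 1 (f i) 0 l" if "i < n" "l < k" for i l
    unfolding h_def by (rule entry_matrix) (use z f that in auto)
  show ?thesis
  proof (rule ex1I[of _ h])
    fix h' assume h': "h' \<in> hom V z (mat_obj V R k n) \<and>
      (\<forall>i<n. mmul k n 1 (const V z (Proj (Mat V R) n i)) h' = f i)"
    then show "h' = h" using char e by (intro mat_eqI[OF _ h]) auto
  qed (use h char e in auto)
qed

lemma Mat_is_theory: "is_theory V (Mat V R)"
  unfolding is_theory_def
proof (intro conjI allI)
  show "is_vcategory V (Mat V R)" by (rule Mat_is_vcategory)
  show "VObj (Mat V R) = UNIV" by (rule Mat_sel)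
  show "exhibits_power V (Mat V R) n 1 n (Proj (Mat V R) n)" for n
    by (rule exhibits_powerI[OF Mat_is_vcategory])
      (use Mat_Proj Mat_tupling in \<open>simp_all add: Mat_sel(1,2)\<close>)
  have "Proj (Mat V R) 1 0 = const V (One V) (Proj (Mat V R) 1 0)"
    using const_One[OF Mat_Proj] by simp
  also have "\<dots> = const V (One V) (VId (Mat V R) 1)"
    by (rule mat_eqI[OF const_hom[OF one_obj Mat_Proj] const_hom[OF one_obj Mat_VId]])
      (simp add: entry_Proj[OF one_obj, simplified] entry_VId[OF one_obj, simplified])
  also have "\<dots> = VId (Mat V R) 1" using const_One[OF Mat_VId] by simp
  finally show "Proj (Mat V R) 1 0 = VId (Mat V R) 1" .
qed

section \<open>Matrices acting on vectors\<close>

text \<open>The first power of an object being that object, matrices with one row and matrices with one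
  column are both just elements of the power \<open>Pw V (Car R) n\<close>; only their entries are indexed
  differently.\<close>

lemma mat_obj_1: "mat_obj V R 1 n = Pw V (Car R) n" "mat_obj V R n 1 = Pw V (Car R) n"
  using pw_1 car_obj mat_objs(2) by (simp_all add: mat_obj_def)

lemma entry_col: "i < n \<Longrightarrow> entry V R 1 n x i 0 = Pr V (Car R) n i \<cdot> x"
  if "x \<in> hom V z (Pw V (Car R) n)"
proof -
  assume i: "i < n"
  have "Pr V (Car R) n i \<cdot> x \<in> hom V z (Car R)" using that i by blast
  from ide_left[OF this] show ?thesis
    using pw_1[OF car_obj] pr_1[OF car_obj] by (simp add: entry_def)
qed

text \<open>A column vector is a matrix with one column, and a matrix acts on it by multiplication: the
  module \<open>R\<close> is the hom functor of \<open>Mat\<close> at \<open>1\<close>.\<close>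

lemma mat_act_eq_postcomp: "mat_act V R n m = postcomp (Mat V R) 1 n m"
proof -
  define x where "x = Pw V (Car R) n"
  define u where "u = mat_obj V R n m \<otimes> x"
  define B where "B = Fst V (mat_obj V R n m) x"
  define A where "A = Snd V (mat_obj V R n m) x"
  define f where "f j i = rsum V R u (\<lambda>q. entry V R n m B j q \<odot> entry V R 1 n A q i) n" for j i
  have u: "u \<in> Obj V" unfolding u_def x_def by auto
  have B: "B \<in> hom V u (mat_obj V R n m)" and A: "A \<in> hom V u x"
    unfolding u_def A_def B_def x_def by auto
  have A': "A \<in> hom V u (mat_obj V R 1 n)" using A mat_obj_1 x_def by simp
  have "VComp (Mat V R) 1 n m = matrix V R u 1 m f"
    using mat_obj_1 by (simp add: Mat_def Let_def f_def[abs_def] u_def A_def B_def x_def)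
  also have "\<dots> = tuple V u (Car R) m (\<lambda>j. rsum V R u (\<lambda>q. entry V R n m B j q \<odot> (Pr V (Car R) n q \<cdot> A)) n)"
    (is "_ = tuple V u _ m ?g")
  proof (rule tuple_eqI)
    have f: "f j i \<in> hom V u (Car R)" if "j < m" "i < 1" for j i
      unfolding f_def by (rule rsum_hom) (use u B A' that in auto)
    have fg: "f j 0 = ?g j" if "j < m" for j
      unfolding f_def by (rule rsum_cong) (use entry_col[OF A[unfolded x_def]] in simp)
    have g: "?g j \<in> hom V u (Car R)" if "j < m" for j
      using f[OF that] fg[OF that] by simp
    show M: "matrix V R u 1 m f \<in> hom V u (Pw V (Car R) m)"
      unfolding mat_obj_1[symmetric] by (rule matrix_hom) (use u f in auto)
    show "tuple V u (Car R) m ?g \<in> hom V u (Pw V (Car R) m)"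
      by (rule tuple_hom) (use u g in auto)
    fix j assume j: "j < m"
    have "Pr V (Car R) m j \<cdot> matrix V R u 1 m f = entry V R 1 m (matrix V R u 1 m f) j 0"
      using entry_col[OF M j] by simp
    also have "\<dots> = f j 0" by (rule entry_matrix) (use u f j in auto)
    also have "\<dots> = Pr V (Car R) m j \<cdot> tuple V u (Car R) m ?g"
      unfolding fg[OF j] by (rule pr_tuple[symmetric]) (use u g j in auto)
    finally show "Pr V (Car R) m j \<cdot> matrix V R u 1 m f = Pr V (Car R) m j \<cdot> tuple V u (Car R) m ?g" .
  qed auto
  finally show ?thesis
    using mat_obj_1 by (simp add: mat_act_def postcomp_def Mat_sel Let_def u_def x_def A_def B_def)
qed

text \<open>The hom-object from \<open>k\<close> to \<open>n\<close> is literally the \<open>n\<close>-th power of \<open>Pw V (Car R) k\<close>, its elements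
  being families of \<open>n\<close> rows. Hence every hom functor of \<open>Mat\<close> is a morphism into a full theory.\<close>

lemma postcomp_Mat_morphism: "is_theory_morphism V (Mat V R) (full_theory V (Pw V (Car R) k)) (postcomp (Mat V R) k)"
proof (rule postcomp_theory_morphism[OF Mat_is_theory])
  show P: "Pw V (Car R) k \<in> Obj V" by auto
  show "VHom (Mat V R) k n = Pw V (Pw V (Car R) k) n" for n by (simp add: Mat_sel mat_obj_def)
  fix n i z x assume i: "i < n" and x: "x \<in> hom V z (Pw V (Pw V (Car R) k) n)"
  have x': "x \<in> hom V z (mat_obj V R k n)" using x by (simp add: mat_obj_def)
  have r: "Pr V (Pw V (Car R) k) n i \<cdot> x \<in> hom V z (mat_obj V R k 1)"
    using x i P mat_obj_1 by auto
  show "mmul k n 1 (const V z (Proj (Mat V R) n i)) x = Pr V (Pw V (Car R) k) n i \<cdot> x"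
  proof (rule mat_eqI[OF mmul_Proj(1)[OF x' i] r])
    fix j l assume "j < (1::nat)" and l: "l < k"
    then have j: "j = 0" by simp
    have "Pr V (Pw V (Car R) k) 1 0 \<cdot> (Pr V (Pw V (Car R) k) n i \<cdot> x) = Pr V (Pw V (Car R) k) n i \<cdot> x"
      using pr_1[OF P] ide_left[OF r] mat_obj_1 by simp
    then show "entry V R k 1 (mmul k n 1 (const V z (Proj (Mat V R) n i)) x) j l
      = entry V R k 1 (Pr V (Pw V (Car R) k) n i \<cdot> x) j l"
      unfolding j mmul_Proj(2)[OF x' i l] by (simp add: entry_def)
  qed
qed

lemma postcomp_Mat_hom: "postcomp (Mat V R) k n m \<in> hom V (mat_obj V R n m) (Exp V (mat_obj V R k n) (mat_obj V R k m))"
  using postcomp_hom[OF Mat_is_vcategory Mat_sel(1)] by (simp add: Mat_sel)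

lemma app_postcomp_Mat: "\<lbrakk>a \<in> hom V z (mat_obj V R n m); x \<in> hom V z (mat_obj V R k n)\<rbrakk> \<Longrightarrow>
    app (mat_obj V R k n) (mat_obj V R k m) (postcomp (Mat V R) k n m \<cdot> a) x = mmul k n m a x"
  using app_postcomp[OF Mat_is_vcategory Mat_sel(1)] by (simp add: Mat_sel)

lemma mat_act_over: "is_theory_over V (Car R) (Mat V R) (mat_act V R)"
proof -
  have "mat_act V R = postcomp (Mat V R) 1" by (intro ext mat_act_eq_postcomp)
  then show ?thesis
    using postcomp_Mat_morphism[of 1] pw_1[OF car_obj] car_obj by (simp add: is_theory_over_def)
qed

definition unit_col where "unit_col z n i = matrix V R z 1 n (\<lambda>i' _. kron z i' i)"

lemma unit_col_hom [intro]: "z \<in> Obj V \<Longrightarrow> unit_col z n i \<in> hom V z (mat_obj V R 1 n)"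
  unfolding unit_col_def by (rule matrix_hom) auto

lemma entry_unit_col: "\<lbrakk>z \<in> Obj V; j < n\<rbrakk> \<Longrightarrow> entry V R 1 n (unit_col z n i) j 0 = kron z j i"
  unfolding unit_col_def by (rule entry_matrix) auto

lemma mmul_unit_col:
  assumes a: "a \<in> hom V z (mat_obj V R n m)" and ji: "j < m" "i < n"
  shows "entry V R 1 m (mmul 1 n m a (unit_col z n i)) j 0 = entry V R n m a j i"
proof -
  have z: "z \<in> Obj V" using a by auto
  have "entry V R 1 m (mmul 1 n m a (unit_col z n i)) j 0
    = rsum V R z (\<lambda>k. entry V R n m a j k \<odot> kron z k i) n"
    unfolding entry_mmul[OF a unit_col_hom[OF z] ji(1) zero_less_one]
    by (rule rsum_cong) (simp only: entry_unit_col[OF z])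
  also have "\<dots> = entry V R n m a j i"
    by (rule rsum_kron_right) (use z a ji in auto)
  finally show ?thesis .
qed

text \<open>The columns of a matrix are its values at the unit columns.\<close>

lemma postcomp_Mat_faithful:
  assumes a: "a \<in> hom V z (mat_obj V R n m)" and b: "b \<in> hom V z (mat_obj V R n m)"
    and eq: "postcomp (Mat V R) 1 n m \<cdot> a = postcomp (Mat V R) 1 n m \<cdot> b"
  shows "a = b"
proof (rule mat_eqI[OF a b])
  fix j i assume ji: "j < m" "i < n"
  have "z \<in> Obj V" using a by auto
  then have "mmul 1 n m a (unit_col z n i) = mmul 1 n m b (unit_col z n i)"
    using app_postcomp_Mat[OF a] app_postcomp_Mat[OF b] eq unit_col_hom by metis
  then show "entry V R n m a j i = entry V R n m b j i"
    using mmul_unit_col[OF a ji] mmul_unit_col[OF b ji] by simp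
qed

lemma mat_act_subtheory: "is_subtheory V (Mat V R) (full_theory V (Car R)) (mat_act V R)"
  unfolding is_subtheory_def
proof (intro conjI allI)
  show "is_theory_morphism V (Mat V R) (full_theory V (Car R)) (mat_act V R)"
    using mat_act_over by (simp add: is_theory_over_def)
  fix n m
  show "is_mono V (mat_act V R n m)"
    using postcomp_Mat_hom[of 1 n m] postcomp_Mat_faithful
    by (auto simp: is_mono_def mat_act_eq_postcomp hom_def)
qed

abbreviation alg_power where "alg_power \<equiv> alg_pw V (Car R) (Mat V R) (mat_act V R)"

text \<open>An element of the \<open>n\<close>-th power of the algebra \<open>R\<close> at \<open>k\<close> is a matrix \<open>x\<close> with \<open>n\<close> rows of length \<open>k\<close>,
  and \<open>t\<close> acts on every row separately. The result is the product of \<open>x\<close> and the transpose of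
  \<open>t\<close>, but with the entries of \<open>t\<close> as left factors.\<close>

lemma alg_pw_Mat:
  shows alg_pw_hom: "alg_power n k l
      \<in> hom V (mat_obj V R k l) (Exp V (mat_obj V R k n) (mat_obj V R l n))"
    and entry_alg_pw: "\<And>z t x i c. \<lbrakk>t \<in> hom V z (mat_obj V R k l); x \<in> hom V z (mat_obj V R k n); i < n; c < l\<rbrakk> \<Longrightarrow>
      entry V R l n (app (mat_obj V R k n) (mat_obj V R l n) (alg_power n k l \<cdot> t) x) i c
      = rsum V R z (\<lambda>d. entry V R k l t c d \<odot> entry V R k n x i d) k"
proof -
  let ?P = "Pw V (Car R)"
  let ?u = "mat_obj V R k l" and ?x = "mat_obj V R k n"
  define F where "F i = Ev V (?P k) (?P l) \<cdot> \<langle>mat_act V R k l \<cdot> Fst V ?u ?x, Pr V (?P k) n i \<cdot> Snd V ?u ?x\<rangle>" for i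
  have eq: "alg_power n k l = curry V ?u ?x (tuple V (?u \<otimes> ?x) (?P l) n F)"
    unfolding alg_pw_def Let_def F_def Mat_sel mat_obj_def ..
  have ma: "mat_act V R k l \<in> hom V ?u (Exp V (?P k) (?P l))"
    unfolding mat_act_eq_postcomp using postcomp_Mat_hom[of 1] mat_obj_1 by simp
  have o: "?u \<in> Obj V" "?x \<in> Obj V" "?P l \<in> Obj V" "?P k \<in> Obj V" by auto
  have fs: "Fst V ?u ?x \<in> hom V (?u \<otimes> ?x) ?u" "Snd V ?u ?x \<in> hom V (?u \<otimes> ?x) ?x" using o by auto
  have pr: "Pr V (?P k) n i \<in> hom V ?x (?P k)" if "i < n" for i
    using pr_hom[OF o(4) that] by (simp add: mat_obj_def)
  have m1: "mat_act V R k l \<cdot> Fst V ?u ?x \<in> hom V (?u \<otimes> ?x) (Exp V (?P k) (?P l))" using ma fs by blast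
  have m2: "Pr V (?P k) n i \<cdot> Snd V ?u ?x \<in> hom V (?u \<otimes> ?x) (?P k)" if "i < n" for i
    using pr[OF that] fs by blast
  have F: "F i \<in> hom V (?u \<otimes> ?x) (?P l)" if "i < n" for i
    unfolding F_def app_def[symmetric] by (rule app_hom[OF m1 m2[OF that] o(3)])
  show "alg_power n k l \<in> hom V ?u (Exp V ?x (mat_obj V R l n))"
    unfolding eq using curry_tuple_hom[OF o(1,2,3) F] by (simp add: mat_obj_def)
  fix z t x i c
  assume t: "t \<in> hom V z ?u" and x: "x \<in> hom V z ?x" and i: "i < n" and c: "c < l"
  have s: "\<langle>t, x\<rangle> \<in> hom V z (?u \<otimes> ?x)" using t x by blast
  let ?xi = "Pr V (?P k) n i \<cdot> x"
  have xi: "?xi \<in> hom V z (?P k)" using pr[OF i] x by blast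
  have xi': "?xi \<in> hom V z (mat_obj V R 1 k)" using xi mat_obj_1 by simp
  have "Pr V (?P l) n i \<cdot> app ?x (mat_obj V R l n) (alg_power n k l \<cdot> t) x
    = F i \<cdot> \<langle>t, x\<rangle>"
    unfolding eq unfolding mat_obj_def[of V R l n] by (rule pr_app_curry_tuple[OF o(1,2,3) F t x i])
  also have "\<dots> = app (?P k) (?P l) ((mat_act V R k l \<cdot> Fst V ?u ?x) \<cdot> \<langle>t, x\<rangle>) ((Pr V (?P k) n i \<cdot> Snd V ?u ?x) \<cdot> \<langle>t, x\<rangle>)"
    unfolding F_def app_def[symmetric] by (rule app_comp[OF m1 m2[OF i] o(3) s])
  also have "(mat_act V R k l \<cdot> Fst V ?u ?x) \<cdot> \<langle>t, x\<rangle> = mat_act V R k l \<cdot> t"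
    using comp_assoc[OF s fs(1) ma] fst_pair[OF t x] by simp
  also have "(Pr V (?P k) n i \<cdot> Snd V ?u ?x) \<cdot> \<langle>t, x\<rangle> = ?xi"
    using comp_assoc[OF s fs(2) pr[OF i]] snd_pair[OF t x] by simp
  also have "app (?P k) (?P l) (mat_act V R k l \<cdot> t) ?xi = mmul 1 k l t ?xi"
    unfolding mat_act_eq_postcomp using app_postcomp_Mat[OF t xi'] mat_obj_1 by simp
  finally have row: "Pr V (?P l) n i \<cdot> app ?x (mat_obj V R l n) (alg_power n k l \<cdot> t) x
    = mmul 1 k l t ?xi" .
  have "mmul 1 k l t ?xi \<in> hom V z (?P l)" using mmul_hom[OF t xi'] mat_obj_1 by simp
  from entry_col[OF this c]
  have "entry V R l n (app ?x (mat_obj V R l n) (alg_power n k l \<cdot> t) x) i c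
     = entry V R 1 l (mmul 1 k l t ?xi) c 0"
    unfolding entry_def row by simp
  also have "\<dots> = rsum V R z (\<lambda>d. entry V R k l t c d \<odot> entry V R 1 k ?xi d 0) k"
    by (rule entry_mmul[OF t xi' c zero_less_one])
  also have "\<dots> = rsum V R z (\<lambda>d. entry V R k l t c d \<odot> entry V R k n x i d) k"
    by (rule rsum_cong) (use entry_col[OF xi] in \<open>simp add: entry_def\<close>)
  finally show "entry V R l n (app ?x (mat_obj V R l n) (alg_power n k l \<cdot> t) x) i c
      = rsum V R z (\<lambda>d. entry V R k l t c d \<odot> entry V R k n x i d) k" .
qed

end

section \<open>The opposite rig\<close>

definition op_rig :: "('o, 'm) ccc \<Rightarrow> ('o, 'm) rig \<Rightarrow> ('o, 'm) rig" where
  "op_rig V R = R\<lparr>Mul := Comp V (Mul R) (pair V (Snd V (Car R) (Car R)) (Fst V (Car R) (Car R)))\<rparr>"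

lemma op_rig_sel [simp]:
  "Car (op_rig V R) = Car R" "Add (op_rig V R) = Add R" "Zer (op_rig V R) = Zer R" "Uni (op_rig V R) = Uni R"
  by (simp_all add: op_rig_def)

lemma op_rig_matrices [simp]:
  "radd V (op_rig V R) = radd V R"
  "rsum V (op_rig V R) z f n = rsum V R z f n"
  "mat_obj V (op_rig V R) = mat_obj V R"
  "entry V (op_rig V R) = entry V R"
  "matrix V (op_rig V R) = matrix V R"
proof -
  show 1: "radd V (op_rig V R) = radd V R" by (simp add: radd_def fun_eq_iff)
  show "rsum V (op_rig V R) z f n = rsum V R z f n" by (induction n) (simp_all add: 1)
qed (simp_all add: fun_eq_iff mat_obj_def entry_def matrix_def)

context rig_elements
begin

lemma swap_hom: "\<langle>Snd V (Car R) (Car R), Fst V (Car R) (Car R)\<rangle> \<in> hom V (Car R \<otimes> Car R) (Car R \<otimes> Car R)"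
  by auto

lemma swap_pair:
  assumes x: "x \<in> hom V z (Car R)" and y: "y \<in> hom V z (Car R)"
  shows "\<langle>Snd V (Car R) (Car R), Fst V (Car R) (Car R)\<rangle> \<cdot> \<langle>x, y\<rangle> = \<langle>y, x\<rangle>"
  using pair_comp[OF snd_hom[OF car_obj car_obj] fst_hom[OF car_obj car_obj] pair_hom[OF x y]]
    fst_pair[OF x y] snd_pair[OF x y] by simp

lemma op_Mul_hom: "Mul (op_rig V R) \<in> hom V (Car R \<otimes> Car R) (Car R)"
  using comp_hom[OF swap_hom mul_arr] by (simp add: op_rig_def)

lemma rmul_op:
  assumes x: "x \<in> hom V z (Car R)" and y: "y \<in> hom V z (Car R)"
  shows "rmul V (op_rig V R) x y = y \<odot> x"
  using comp_assoc[OF pair_hom[OF x y] swap_hom mul_arr] swap_pair[OF x y]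
  by (simp add: rmul_def op_rig_def)

lemma op_is_rig: "is_rig V (op_rig V R)"
  unfolding is_rig_def op_rig_sel op_rig_matrices
proof (intro conjI ballI)
  fix z x y w
  assume z: "z \<in> Obj V" and x: "x \<in> hom V z (Car R)" and y: "y \<in> hom V z (Car R)" and w: "w \<in> hom V z (Car R)"
  have zu: "zer z \<in> hom V z (Car R)" "const V z (Uni R) \<in> hom V z (Car R)" using z by auto
  show "(x \<oplus> y) \<oplus> w = x \<oplus> (y \<oplus> w)" by (rule radd_assoc[OF x y w])
  show "x \<oplus> y = y \<oplus> x" by (rule radd_commute[OF x y])
  show "zer z \<oplus> x = x" by (rule zer_radd[OF x])
  show "rmul V (op_rig V R) (rmul V (op_rig V R) x y) w = rmul V (op_rig V R) x (rmul V (op_rig V R) y w)"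
    unfolding rmul_op[OF x y] rmul_op[OF y w] rmul_op[OF rmul_hom[OF y x] w] rmul_op[OF x rmul_hom[OF w y]]
    by (rule rmul_assoc[OF w y x, symmetric])
  show "rmul V (op_rig V R) (const V z (Uni R)) x = x" "rmul V (op_rig V R) x (const V z (Uni R)) = x"
    "rmul V (op_rig V R) x (zer z) = zer z" "rmul V (op_rig V R) (zer z) x = zer z"
    using x zu by (simp_all add: rmul_op rig_unit_laws)
  show "rmul V (op_rig V R) x (y \<oplus> w) = rmul V (op_rig V R) x y \<oplus> rmul V (op_rig V R) x w"
    unfolding rmul_op[OF x radd_hom[OF y w]] rmul_op[OF x y] rmul_op[OF x w] by (rule radd_rmul[OF y w x])
  show "rmul V (op_rig V R) (x \<oplus> y) w = rmul V (op_rig V R) x w \<oplus> rmul V (op_rig V R) y w"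
    unfolding rmul_op[OF radd_hom[OF x y] w] rmul_op[OF x w] rmul_op[OF y w] by (rule rmul_radd[OF w x y])
qed (use car_obj add_arr zer_arr op_Mul_hom uni_arr in auto)

lemma op_rig_elements: "rig_elements V (op_rig V R)"
  by unfold_locales (rule op_is_rig)

text \<open>An arrow is its own value at the generic pair; so the multiplication of a rig is determined by
  what it does to elements.\<close>

lemma Mul_eq_rmul: "Mul R = rmul V R (Fst V (Car R) (Car R)) (Snd V (Car R) (Car R))"
proof -
  have f: "Fst V (Car R) (Car R) \<in> hom V (Car R \<otimes> Car R) (Car R)"
    and s: "Snd V (Car R) (Car R) \<in> hom V (Car R \<otimes> Car R) (Car R)" by auto
  have P: "Car R \<otimes> Car R \<in> Obj V" by auto
  have "\<langle>Fst V (Car R) (Car R), Snd V (Car R) (Car R)\<rangle> = Ide V (Car R \<otimes> Car R)"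
    by (rule pair_eqI[OF pair_hom[OF f s] ide_hom[OF P] car_obj car_obj])
      (simp_all add: fst_pair[OF f s] snd_pair[OF f s] ide_right[OF f] ide_right[OF s])
  then show ?thesis unfolding rmul_def using ide_right[OF mul_arr] by simp
qed

lemma op_rig_eqI:
  assumes "rmul V (op_rig V R) (Fst V (Car R) (Car R)) (Snd V (Car R) (Car R))
    = Fst V (Car R) (Car R) \<odot> Snd V (Car R) (Car R)"
  shows "op_rig V R = R"
proof -
  interpret op: rig_elements V "op_rig V R" by (rule op_rig_elements)
  have "Mul (op_rig V R) = Mul R"
    using op.Mul_eq_rmul Mul_eq_rmul assms by simp
  then show ?thesis by (cases R) (simp add: op_rig_def)
qed

lemma op_op_rig: "op_rig V (op_rig V R) = R"
proof -
  interpret op: rig_elements V "op_rig V R" by (rule op_rig_elements)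
  interpret opop: rig_elements V "op_rig V (op_rig V R)" by (rule op.op_rig_elements)
  have f: "Fst V (Car R) (Car R) \<in> hom V (Car R \<otimes> Car R) (Car R)"
    and s: "Snd V (Car R) (Car R) \<in> hom V (Car R \<otimes> Car R) (Car R)" by auto
  have "Mul (op_rig V (op_rig V R)) = Mul R"
    using opop.Mul_eq_rmul Mul_eq_rmul op.rmul_op f s rmul_op[OF s f] by simp
  then show ?thesis by (cases R) (simp add: op_rig_def)
qed

lemma op_commutative_rig:
  assumes "is_commutative_rig V R"
  shows "op_rig V R = R"
proof (rule op_rig_eqI)
  have f: "Fst V (Car R) (Car R) \<in> hom V (Car R \<otimes> Car R) (Car R)"
    and s: "Snd V (Car R) (Car R) \<in> hom V (Car R \<otimes> Car R) (Car R)" by auto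
  show "rmul V (op_rig V R) (Fst V (Car R) (Car R)) (Snd V (Car R) (Car R))
    = Fst V (Car R) (Car R) \<odot> Snd V (Car R) (Car R)"
    using assms f s hom_obj(1)[OF f] unfolding rmul_op[OF f s] is_commutative_rig_def by blast
qed

section \<open>The commutant of a theory of matrices\<close>

text \<open>Left multiplication by a matrix \<open>a\<close> over the opposite rig is, over \<open>R\<close> itself, the operation that
  combines the rows of \<open>x\<close> with coefficients from \<open>a\<close> as right factors.\<close>

abbreviation opmul where "opmul k n m a x \<equiv> vcomp V (Mat V (op_rig V R)) k n m a x"
abbreviation pw_act where
  "pw_act n k l t x \<equiv> app (mat_obj V R k n) (mat_obj V R l n) (alg_power n k l \<cdot> t) x"
abbreviation ev_at where "ev_at n m k \<equiv> postcomp (Mat V (op_rig V R)) k n m"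

lemma entry_opmul:
  assumes a: "a \<in> hom V z (mat_obj V R n m)" and x: "x \<in> hom V z (mat_obj V R k n)"
  shows opmul_hom: "opmul k n m a x \<in> hom V z (mat_obj V R k m)"
    and "\<And>j l. \<lbrakk>j < m; l < k\<rbrakk> \<Longrightarrow> entry V R k m (opmul k n m a x) j l
      = rsum V R z (\<lambda>i. entry V R k n x i l \<odot> entry V R n m a j i) n"
proof -
  interpret op: rig_elements V "op_rig V R" by (rule op_rig_elements)
  show "opmul k n m a x \<in> hom V z (mat_obj V R k m)"
    using op.mmul_hom a x by simp
  fix j l assume jl: "j < m" "l < k"
  have "entry V R k m (opmul k n m a x) j l
     = rsum V R z (\<lambda>i. rmul V (op_rig V R) (entry V R n m a j i) (entry V R k n x i l)) n"
    using op.entry_mmul[of a z n m x k j l] a x jl by simp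
  also have "\<dots> = rsum V R z (\<lambda>i. entry V R k n x i l \<odot> entry V R n m a j i) n"
    by (rule rsum_cong) (use a x jl in \<open>auto intro!: rmul_op\<close>)
  finally show "entry V R k m (opmul k n m a x) j l
      = rsum V R z (\<lambda>i. entry V R k n x i l \<odot> entry V R n m a j i) n" .
qed

lemma pw_act_hom:
  "\<lbrakk>t \<in> hom V z (mat_obj V R k l); x \<in> hom V z (mat_obj V R k n)\<rbrakk> \<Longrightarrow> pw_act n k l t x \<in> hom V z (mat_obj V R l n)"
  by (rule app_hom[OF comp_hom[OF _ alg_pw_hom]]) auto

text \<open>The rows of \<open>x\<close> are transformed by left multiplications and combined by right multiplications.
  By associativity of the rig multiplication and interchange of sums the two operations commute;
  this is why matrices over the opposite rig are natural transformations.\<close>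

lemma opmul_pw_act:
  assumes a: "a \<in> hom V z (mat_obj V R n m)" and t: "t \<in> hom V z (mat_obj V R k l)"
    and x: "x \<in> hom V z (mat_obj V R k n)"
  shows "opmul l n m a (pw_act n k l t x) = pw_act m k l t (opmul k n m a x)"
proof (rule mat_eqI)
  have z: "z \<in> Obj V" using a by auto
  have tx: "pw_act n k l t x \<in> hom V z (mat_obj V R l n)" by (rule pw_act_hom[OF t x])
  have ax: "opmul k n m a x \<in> hom V z (mat_obj V R k m)" by (rule opmul_hom[OF a x])
  show "opmul l n m a (pw_act n k l t x) \<in> hom V z (mat_obj V R l m)" by (rule opmul_hom[OF a tx])
  show "pw_act m k l t (opmul k n m a x) \<in> hom V z (mat_obj V R l m)" by (rule pw_act_hom[OF t ax])
  fix j c assume j: "j < m" and c: "c < l"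
  let ?t = "entry V R k l t" and ?a = "entry V R n m a" and ?x = "entry V R k n x"
  have h: "?t c d \<in> hom V z (Car R)" "?x i d \<in> hom V z (Car R)" "?a j i \<in> hom V z (Car R)"
    if "d < k" "i < n" for d i
    using that j c a t x by auto
  have "entry V R l m (opmul l n m a (pw_act n k l t x)) j c
      = rsum V R z (\<lambda>i. rsum V R z (\<lambda>d. ?t c d \<odot> (?x i d \<odot> ?a j i)) k) n"
    unfolding entry_opmul(2)[OF a tx j c]
  proof (rule rsum_cong)
    fix i assume i: "i < n"
    have "entry V R l n (pw_act n k l t x) i c \<odot> ?a j i = rsum V R z (\<lambda>d. (?t c d \<odot> ?x i d) \<odot> ?a j i) k"
      unfolding entry_alg_pw[OF t x i c]
      by (rule rsum_rmul[OF entry_hom[OF a j i]]) (intro rmul_hom h(1)[OF _ i] h(2)[OF _ i])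
    also have "\<dots> = rsum V R z (\<lambda>d. ?t c d \<odot> (?x i d \<odot> ?a j i)) k"
      by (rule rsum_cong, rule rmul_assoc[OF h(1)[OF _ i] h(2)[OF _ i] h(3)[OF _ i]]) auto
    finally show "entry V R l n (pw_act n k l t x) i c \<odot> ?a j i = rsum V R z (\<lambda>d. ?t c d \<odot> (?x i d \<odot> ?a j i)) k" .
  qed
  also have "\<dots> = rsum V R z (\<lambda>d. rsum V R z (\<lambda>i. ?t c d \<odot> (?x i d \<odot> ?a j i)) n) k"
    by (rule rsum_swap[OF z]) (intro rmul_hom h)
  also have "\<dots> = entry V R l m (pw_act m k l t (opmul k n m a x)) j c"
    unfolding entry_alg_pw[OF t ax j c]
  proof (rule rsum_cong)
    fix d assume d: "d < k"
    show "rsum V R z (\<lambda>i. ?t c d \<odot> (?x i d \<odot> ?a j i)) n = ?t c d \<odot> entry V R k m (opmul k n m a x) j d"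
      unfolding entry_opmul(2)[OF a x j d]
      by (rule rmul_rsum[OF entry_hom[OF t c d], symmetric]) (intro rmul_hom h(2)[OF d] h(3)[OF d])
  qed
  finally show "entry V R l m (opmul l n m a (pw_act n k l t x)) j c
    = entry V R l m (pw_act m k l t (opmul k n m a x)) j c" .
qed

abbreviation natural where
  "natural n m z q \<equiv> is_natural_family V (Mat V R)
     (\<lambda>k. Pw V (Pw V (Car R) k) n) (alg_power n)
     (\<lambda>k. Pw V (Pw V (Car R) k) m) (alg_power m) z q"

lemma alg_pw_hom': "alg_power n k l \<in>
    hom V (VHom (Mat V R) k l) (Exp V (Pw V (Pw V (Car R) k) n) (Pw V (Pw V (Car R) l) n))"
  using alg_pw_hom by (simp add: Mat_sel mat_obj_def)

lemma natural_hom: "natural n m z q \<Longrightarrow> q k \<in> hom V z (Exp V (mat_obj V R k n) (mat_obj V R k m))"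
  by (simp add: is_natural_family_def Mat_sel mat_obj_def)

lemma natural_app:
  assumes "natural n m z q" "s \<in> hom V w z" "t \<in> hom V w (mat_obj V R k l)" "x \<in> hom V w (mat_obj V R k n)"
  shows "app (mat_obj V R l n) (mat_obj V R l m) (q l \<cdot> s) (pw_act n k l t x)
        = pw_act m k l t (app (mat_obj V R k n) (mat_obj V R k m) (q k \<cdot> s) x)"
  using natural_familyD[OF assms(1) alg_pw_hom'[of n k l] alg_pw_hom'[of m k l], of s w t x] assms(2-4)
  by (simp add: Mat_sel mat_obj_def pw_obj car_obj)

lemma ev_at_natural: "natural n m (mat_obj V R n m) (ev_at n m)"
proof (rule natural_familyI)
  interpret op: rig_elements V "op_rig V R" by (rule op_rig_elements)
  show "mat_obj V R n m \<in> Obj V" by auto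
  have h: "ev_at n m k \<in> hom V (mat_obj V R n m) (Exp V (mat_obj V R k n) (mat_obj V R k m))" for k
    using op.postcomp_Mat_hom by simp
  then show "ev_at n m k \<in> hom V (mat_obj V R n m) (Exp V (Pw V (Pw V (Car R) k) n) (Pw V (Pw V (Car R) k) m))" for k
    by (simp add: mat_obj_def)
  have ev: "app (mat_obj V R k n) (mat_obj V R k m) (ev_at n m k \<cdot> a) x = opmul k n m a x"
    if "a \<in> hom V w (mat_obj V R n m)" "x \<in> hom V w (mat_obj V R k n)" for a x k w
    using op.app_postcomp_Mat that by simp
  fix k l w s t x
  assume s: "s \<in> hom V w (mat_obj V R n m)" and "t \<in> hom V w (VHom (Mat V R) k l)"
    and "x \<in> hom V w (Pw V (Pw V (Car R) k) n)"
  then have t: "t \<in> hom V w (mat_obj V R k l)" and x: "x \<in> hom V w (mat_obj V R k n)"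
    by (simp_all add: Mat_sel mat_obj_def)
  show "app (Pw V (Pw V (Car R) l) n) (Pw V (Pw V (Car R) l) m) (ev_at n m l \<cdot> s)
       (app (Pw V (Pw V (Car R) k) n) (Pw V (Pw V (Car R) l) n) (alg_power n k l \<cdot> t) x)
      = app (Pw V (Pw V (Car R) k) m) (Pw V (Pw V (Car R) l) m) (alg_power m k l \<cdot> t)
       (app (Pw V (Pw V (Car R) k) n) (Pw V (Pw V (Car R) k) m) (ev_at n m k \<cdot> s) x)"
    using opmul_pw_act[OF s t x] ev[OF s pw_act_hom[OF t x]] ev[OF s x] by (simp add: mat_obj_def)
qed (use alg_pw_hom' in auto)

text \<open>Naturality with respect to the projection from \<open>k\<close> to \<open>1\<close> with index \<open>l\<close>, which acts on a matrix by
  extracting column \<open>l\<close>: every component of a natural family is determined, column by column, by the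
  component at \<open>1\<close>.\<close>

lemma natural_column:
  assumes q: "natural n m z q" and s: "s \<in> hom V w z" and x: "x \<in> hom V w (mat_obj V R k n)"
    and j: "j < m" and l: "l < k"
  shows "entry V R k m (app (mat_obj V R k n) (mat_obj V R k m) (q k \<cdot> s) x) j l
    = entry V R 1 m (app (mat_obj V R 1 n) (mat_obj V R 1 m) (q 1 \<cdot> s) (matrix V R w 1 n (\<lambda>i _. entry V R k n x i l))) j 0"
proof -
  have w: "w \<in> Obj V" using s by auto
  define t where "t = const V w (Proj (Mat V R) k l)"
  have t: "t \<in> hom V w (mat_obj V R k 1)" unfolding t_def using Mat_Proj w by blast
  have pick: "entry V R 1 p (pw_act p k 1 t y) i 0 = entry V R k p y i l"
    if y: "y \<in> hom V w (mat_obj V R k p)" and i: "i < p" for p y i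
  proof -
    have "entry V R 1 p (pw_act p k 1 t y) i 0 = rsum V R w (\<lambda>d. kron w l d \<odot> entry V R k p y i d) k"
      unfolding entry_alg_pw[OF t y i zero_less_one]
      by (rule rsum_cong) (simp only: t_def entry_Proj[OF w])
    also have "\<dots> = entry V R k p y i l" by (rule rsum_kron_left) (use w y i l in auto)
    finally show ?thesis .
  qed
  have c: "matrix V R w 1 n (\<lambda>i _. entry V R k n x i l) \<in> hom V w (mat_obj V R 1 n)"
    by (rule matrix_hom) (use w x l in auto)
  have col: "pw_act n k 1 t x = matrix V R w 1 n (\<lambda>i _. entry V R k n x i l)"
  proof (rule mat_eqI[OF pw_act_hom[OF t x] c])
    fix i c assume i: "i < n" and "c < (1::nat)"
    then have c: "c = 0" by simp
    have "entry V R 1 n (matrix V R w 1 n (\<lambda>i _. entry V R k n x i l)) i 0 = entry V R k n x i l"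
      by (rule entry_matrix) (use w x i l in auto)
    then show "entry V R 1 n (pw_act n k 1 t x) i c = entry V R 1 n (matrix V R w 1 n (\<lambda>i _. entry V R k n x i l)) i c"
      unfolding c pick[OF x i] by simp
  qed
  have "app (mat_obj V R k n) (mat_obj V R k m) (q k \<cdot> s) x \<in> hom V w (mat_obj V R k m)"
    using natural_hom[OF q] s x by blast
  from pick[OF this j] show ?thesis
    unfolding natural_app[OF q s t x, symmetric] col by simp
qed

text \<open>The component of a natural family \<open>q\<close> at \<open>1\<close> is linear, because an element \<open>y\<close> of the \<open>n\<close>-th
  power of \<open>Car R\<close> is itself an operation of arity \<open>n\<close>, namely its transpose \<open>t\<close>, and this operation
  maps the identity matrix to \<open>y\<close>. Naturality with respect to \<open>t\<close> expresses the value at \<open>y\<close> by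
  the values at the unit columns, and these are the columns of the matrix \<open>h\<close> that represents \<open>q\<close>.\<close>

lemma ev_at_universal:
  assumes q: "natural n m z q"
  shows "\<exists>h \<in> hom V z (mat_obj V R n m). \<forall>k. ev_at n m k \<cdot> h = q k"
proof -
  interpret op: rig_elements V "op_rig V R" by (rule op_rig_elements)
  let ?A = "\<lambda>k. app (mat_obj V R k n) (mat_obj V R k m)"
  have z: "z \<in> Obj V" using q by (simp add: is_natural_family_def)
  have qh: "q k \<in> hom V z (Exp V (mat_obj V R k n) (mat_obj V R k m))" for k by (rule natural_hom[OF q])
  have Ah: "?A k (q k \<cdot> s) x \<in> hom V w (mat_obj V R k m)"
    if "s \<in> hom V w z" "x \<in> hom V w (mat_obj V R k n)" for k s x w
    using qh that by blast
  define u where "u i = ?A 1 (q 1) (unit_col z n i)" for i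
  have u: "u i \<in> hom V z (mat_obj V R 1 m)" for i
    unfolding u_def using qh[of 1] z by blast
  define h where "h = matrix V R z n m (\<lambda>j i. entry V R 1 m (u i) j 0)"
  have h: "h \<in> hom V z (mat_obj V R n m)"
    unfolding h_def by (rule matrix_hom) (use z u in auto)
  \<comment> \<open>The entries of a unit column are constants, so a change of stage sends unit columns to unit columns.\<close>
  have eh: "entry V R n m (h \<cdot> s) j i = entry V R 1 m (?A 1 (q 1 \<cdot> s) (unit_col w n i)) j 0"
    if s: "s \<in> hom V w z" and ji: "j < m" "i < n" for s w j i
  proof -
    have uc: "unit_col z n i \<cdot> s = unit_col w n i"
    proof -
      have "unit_col z n i \<cdot> s = matrix V R w 1 n (\<lambda>i' _. kron z i' i \<cdot> s)"
        unfolding unit_col_def by (rule matrix_comp[OF s]) (use z in auto)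
      then show ?thesis unfolding unit_col_def const_comp[OF kron_arr s] .
    qed
    have "entry V R n m (h \<cdot> s) j i = entry V R n m h j i \<cdot> s" by (rule entry_comp[OF h s ji])
    also have "entry V R n m h j i = entry V R 1 m (u i) j 0"
      unfolding h_def by (rule entry_matrix) (use z u ji in auto)
    also have "\<dots> \<cdot> s = entry V R 1 m (u i \<cdot> s) j 0"
      by (rule entry_comp[OF u s ji(1) zero_less_one, symmetric])
    also have "u i \<cdot> s = ?A 1 (q 1 \<cdot> s) (unit_col w n i)"
      unfolding u_def uc[symmetric] by (rule app_comp[OF qh unit_col_hom[OF z] mat_objs(1) s])
    finally show ?thesis .
  qed
  have lin: "entry V R 1 m (?A 1 (q 1 \<cdot> s) y) j 0
      = rsum V R w (\<lambda>i. entry V R 1 n y i 0 \<odot> entry V R n m (h \<cdot> s) j i) n"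
    if s: "s \<in> hom V w z" and y: "y \<in> hom V w (mat_obj V R 1 n)" and j: "j < m" for s w y j
  proof -
    have w: "w \<in> Obj V" using s by auto
    define t where "t = matrix V R w n 1 (\<lambda>_ i. entry V R 1 n y i 0)"
    have t: "t \<in> hom V w (mat_obj V R n 1)" unfolding t_def by (rule matrix_hom) (use w y in auto)
    have et: "entry V R n 1 t 0 i = entry V R 1 n y i 0" if "i < n" for i
      unfolding t_def by (rule entry_matrix) (use w y that in auto)
    define I where "I = const V w (VId (Mat V R) n)"
    have I: "I \<in> hom V w (mat_obj V R n n)" unfolding I_def using w Mat_VId by blast
    \<comment> \<open>The operation \<open>t\<close> applied to the unit vectors, which are the rows of \<open>I\<close>, gives back \<open>y\<close>.\<close>
    have yI: "pw_act n n 1 t I = y"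
    proof (rule mat_eqI[OF pw_act_hom[OF t I] y])
      fix i c assume i: "i < n" and "c < (1::nat)"
      then have c: "c = 0" by simp
      have eI: "entry V R n n I i d = kron w d i" if "d < n" for d
        unfolding I_def entry_VId[OF w i that] by (simp add: eq_commute)
      have "entry V R 1 n (pw_act n n 1 t I) i 0 = rsum V R w (\<lambda>d. entry V R 1 n y d 0 \<odot> kron w d i) n"
        unfolding entry_alg_pw[OF t I i zero_less_one]
        by (rule rsum_cong) (simp only: et eI)
      also have "\<dots> = entry V R 1 n y i 0" by (rule rsum_kron_right) (use w y i in auto)
      finally show "entry V R 1 n (pw_act n n 1 t I) i c = entry V R 1 n y i c" unfolding c .
    qed
    have col: "matrix V R w 1 n (\<lambda>i _. entry V R n n I i d) = unit_col w n d" if d: "d < n" for d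
    proof (rule mat_eqI)
      show "matrix V R w 1 n (\<lambda>i _. entry V R n n I i d) \<in> hom V w (mat_obj V R 1 n)"
        by (rule matrix_hom) (use w I d in auto)
      show "unit_col w n d \<in> hom V w (mat_obj V R 1 n)" using w by (rule unit_col_hom)
      fix i c assume i: "i < n" and "c < (1::nat)"
      then have c: "c = 0" by simp
      have "entry V R 1 n (matrix V R w 1 n (\<lambda>i _. entry V R n n I i d)) i 0 = entry V R n n I i d"
        by (rule entry_matrix) (use w I d i in auto)
      then show "entry V R 1 n (matrix V R w 1 n (\<lambda>i _. entry V R n n I i d)) i c = entry V R 1 n (unit_col w n d) i c"
        unfolding c entry_unit_col[OF w i] unfolding I_def entry_VId[OF w i d] .
    qed
    have "entry V R 1 m (?A 1 (q 1 \<cdot> s) y) j 0 = entry V R 1 m (pw_act m n 1 t (?A n (q n \<cdot> s) I)) j 0"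
      using natural_app[OF q s t I] unfolding yI by simp
    also have "\<dots> = rsum V R w (\<lambda>d. entry V R n 1 t 0 d \<odot> entry V R n m (?A n (q n \<cdot> s) I) j d) n"
      by (rule entry_alg_pw[OF t Ah[OF s I] j zero_less_one])
    also have "\<dots> = rsum V R w (\<lambda>d. entry V R 1 n y d 0 \<odot> entry V R n m (h \<cdot> s) j d) n"
    proof (rule rsum_cong)
      fix d assume d: "d < n"
      show "entry V R n 1 t 0 d \<odot> entry V R n m (?A n (q n \<cdot> s) I) j d
        = entry V R 1 n y d 0 \<odot> entry V R n m (h \<cdot> s) j d"
        unfolding et[OF d] eh[OF s j d] natural_column[OF q s I j d] col[OF d] ..
    qed
    finally show ?thesis .
  qed
  have "ev_at n m k \<cdot> h = q k" for k
  proof (rule exp_ext)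
    have ev: "ev_at n m k \<in> hom V (mat_obj V R n m) (Exp V (mat_obj V R k n) (mat_obj V R k m))"
      using op.postcomp_Mat_hom by simp
    then show "ev_at n m k \<cdot> h \<in> hom V z (Exp V (mat_obj V R k n) (mat_obj V R k m))" using h by blast
    show "q k \<in> hom V z (Exp V (mat_obj V R k n) (mat_obj V R k m))" by (rule qh)
    fix w s x assume w: "w \<in> Obj V" and s: "s \<in> hom V w z" and x: "x \<in> hom V w (mat_obj V R k n)"
    have hs: "h \<cdot> s \<in> hom V w (mat_obj V R n m)" using h s by blast
    have "?A k ((ev_at n m k \<cdot> h) \<cdot> s) x = opmul k n m (h \<cdot> s) x"
      unfolding comp_assoc[OF s h ev, symmetric] using op.app_postcomp_Mat hs x by simp
    also have "\<dots> = ?A k (q k \<cdot> s) x"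
    proof (rule mat_eqI[OF opmul_hom[OF hs x] Ah[OF s x]])
      fix j l assume j: "j < m" and l: "l < k"
      define y where "y = matrix V R w 1 n (\<lambda>i _. entry V R k n x i l)"
      have y: "y \<in> hom V w (mat_obj V R 1 n)" unfolding y_def by (rule matrix_hom) (use w x l in auto)
      have ey: "entry V R 1 n y i 0 = entry V R k n x i l" if "i < n" for i
        unfolding y_def by (rule entry_matrix) (use w x l that in auto)
      have "entry V R k m (?A k (q k \<cdot> s) x) j l
        = rsum V R w (\<lambda>i. entry V R 1 n y i 0 \<odot> entry V R n m (h \<cdot> s) j i) n"
        unfolding natural_column[OF q s x j l] y_def[symmetric] by (rule lin[OF s y j])
      also have "\<dots> = rsum V R w (\<lambda>i. entry V R k n x i l \<odot> entry V R n m (h \<cdot> s) j i) n"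
        by (rule rsum_cong) (simp only: ey)
      finally show "entry V R k m (opmul k n m (h \<cdot> s) x) j l = entry V R k m (?A k (q k \<cdot> s) x) j l"
        unfolding entry_opmul(2)[OF hs x j l] ..
    qed
    finally show "?A k ((ev_at n m k \<cdot> h) \<cdot> s) x = ?A k (q k \<cdot> s) x" .
  qed auto
  then show ?thesis using h by blast
qed

text \<open>The evaluation at \<open>k\<close> is left multiplication of matrices with \<open>k\<close> columns. That these evaluations
  are functors is the associativity of multiplication over the opposite rig, and a morphism into the
  object of natural transformations is unique because already the evaluation at \<open>1\<close> is faithful.\<close>

theorem Mat_commutant:
  "is_commutant V (Car R) (Mat V R) (mat_act V R) (Mat V (op_rig V R)) (mat_act V (op_rig V R))"
proof -
  interpret op: rig_elements V "op_rig V R" by (rule op_rig_elements)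
  have uniq: "h = h'" if h: "h \<in> hom V z (mat_obj V R n m)" "h' \<in> hom V z (mat_obj V R n m)"
    and eq: "\<forall>k. ev_at n m k \<cdot> h = ev_at n m k \<cdot> h'" for h h' z n m
    by (rule op.postcomp_Mat_faithful[of h z n m]) (use h eq in auto)
  have "is_nat_object V (Mat V R)
     (\<lambda>k. Pw V (Pw V (Car R) k) n) (alg_power n)
     (\<lambda>k. Pw V (Pw V (Car R) k) m) (alg_power m)
     (mat_obj V R n m) (ev_at n m)" for n m
    unfolding is_nat_object_def
  proof (intro conjI allI impI ev_at_natural)
    fix z q assume q: "natural n m z q"
    show "\<exists>!h. h \<in> hom V z (mat_obj V R n m) \<and> (\<forall>k \<in> VObj (Mat V R). ev_at n m k \<cdot> h = q k)"
      using ev_at_universal[OF q] uniq[of _ z n m] by (auto simp: Mat_sel(1))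
  qed
  then show ?thesis
    unfolding is_commutant_def
    using mat_act_over op.mat_act_over op.postcomp_Mat_morphism op.mat_act_eq_postcomp
    by (intro conjI exI[of _ ev_at]) (auto simp: op.Mat_sel(2))
qed

section \<open>Commutativity\<close>

lemma thy_tuple_Mat:
  assumes z: "z \<in> Obj V" and f: "\<And>i. i < n \<Longrightarrow> f i \<in> hom V z (mat_obj V R k 1)"
  shows thy_tuple_hom: "thy_tuple V (Mat V R) z k n f \<in> hom V z (mat_obj V R k n)"
    and entry_thy_tuple: "\<And>i l. \<lbrakk>i < n; l < k\<rbrakk> \<Longrightarrow>
      entry V R k n (thy_tuple V (Mat V R) z k n f) i l = entry V R k 1 (f i) 0 l"
proof -
  let ?t = "thy_tuple V (Mat V R) z k n f"
  have "\<exists>!h. h \<in> hom V z (mat_obj V R k n) \<and>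
      (\<forall>i<n. mmul k n 1 (const V z (Proj (Mat V R) n i)) h = f i)"
    by (rule Mat_tupling) (use z f in auto)
  from theI'[OF this] have t: "?t \<in> hom V z (mat_obj V R k n)"
    and p: "\<And>i. i < n \<Longrightarrow> mmul k n 1 (const V z (Proj (Mat V R) n i)) ?t = f i"
    unfolding thy_tuple_def Mat_sel(2) by blast+
  show "?t \<in> hom V z (mat_obj V R k n)" by (rule t)
  show "entry V R k n ?t i l = entry V R k 1 (f i) 0 l" if "i < n" "l < k" for i l
    using mmul_Proj(2)[OF t that] unfolding p[OF that(1)] by simp
qed

text \<open>A double sum against a row of an identity matrix, when the two summation indices together label
  the entries of that row.\<close>

lemma rsum_rsum_kron:
  assumes z: "z \<in> Obj V" and a: "\<And>i. i < n \<Longrightarrow> a i \<in> hom V z (Car R)" and b: "\<And>j. j < m \<Longrightarrow> b j \<in> hom V z (Car R)"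
    and p: "p < n" and q: "q < m" and idx: "\<And>i j. \<lbrakk>i < n; j < m\<rbrakk> \<Longrightarrow> idx i j = l \<longleftrightarrow> i = p \<and> j = q"
  shows "rsum V R z (\<lambda>i. a i \<odot> rsum V R z (\<lambda>j. b j \<odot> kron z (idx i j) l) m) n = a p \<odot> b q"
proof -
  have inner: "rsum V R z (\<lambda>j. b j \<odot> kron z (idx p j) l) m = b q"
  proof -
    have "rsum V R z (\<lambda>j. b j \<odot> kron z (idx p j) l) m = rsum V R z (\<lambda>j. b j \<odot> kron z j q) m"
      by (rule rsum_cong) (simp add: idx[OF p])
    also have "\<dots> = b q" by (rule rsum_kron_right) (use z b q in auto)
    finally show ?thesis .
  qed
  have outer: "rsum V R z (\<lambda>j. b j \<odot> kron z (idx i j) l) m = zer z" if "i < n" "i \<noteq> p" for i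
    by (rule rsum_zer[OF z]) (use idx[OF that(1)] that(2) rmul_zer[OF b] in simp)
  have "rsum V R z (\<lambda>i. a i \<odot> rsum V R z (\<lambda>j. b j \<odot> kron z (idx i j) l) m) n
    = a p \<odot> rsum V R z (\<lambda>j. b j \<odot> kron z (idx p j) l) m"
    by (rule rsum_single) (use z a b p q inner outer rmul_zer[OF a] in auto)
  then show ?thesis unfolding inner .
qed

text \<open>Entry \<open>l\<close> of either composite is a double sum in which only the summand with \<open>i = l div m\<close> and
  \<open>j = l mod m\<close> survives. What is left is \<open>\<mu> i \<odot> \<nu> j\<close> for one composite and \<open>\<nu> j \<odot> \<mu> i\<close> for the
  other.\<close>

lemma Mat_is_commutative_theory:
  assumes comm: "is_commutative_rig V R"
  shows "is_commutative_theory V (Mat V R)"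
  unfolding is_commutative_theory_def Let_def
proof (intro conjI allI Mat_is_theory, unfold Mat_sel(2))
  fix n m
  define z where "z = mat_obj V R n 1 \<otimes> mat_obj V R m 1"
  define u where "u = Fst V (mat_obj V R n 1) (mat_obj V R m 1)"
  define v where "v = Snd V (mat_obj V R n 1) (mat_obj V R m 1)"
  have z: "z \<in> Obj V" and u: "u \<in> hom V z (mat_obj V R n 1)" and v: "v \<in> hom V z (mat_obj V R m 1)"
    unfolding z_def u_def v_def by auto
  let ?N = "n * m"
  let ?tup = "thy_tuple V (Mat V R) z ?N"
  define e where "e i j = const V z (Proj (Mat V R) ?N (i * m + j))" for i j
  have e: "e i j \<in> hom V z (mat_obj V R ?N 1)" for i j
    unfolding e_def using z Mat_Proj by blast
  have ee: "entry V R ?N 1 (e i j) 0 l = kron z (i * m + j) l" if "l < ?N" for i j l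
    unfolding e_def by (rule entry_Proj[OF z that])
  have row: "?tup m (e i) \<in> hom V z (mat_obj V R ?N m)"
    and col: "?tup n (\<lambda>i. e i j) \<in> hom V z (mat_obj V R ?N n)" for i j
    using thy_tuple_hom[OF z] e by auto
  \<comment> \<open>Both composites have this shape: with \<open>r\<close> the family of rows, respectively of columns.\<close>
  have composite: "mmul ?N p 1 a (?tup p (\<lambda>i. mmul ?N q 1 b (r i))) \<in> hom V z (mat_obj V R ?N 1)
      \<and> (\<forall>l<?N. entry V R ?N 1 (mmul ?N p 1 a (?tup p (\<lambda>i. mmul ?N q 1 b (r i)))) 0 l
        = rsum V R z (\<lambda>i. entry V R p 1 a 0 i \<odot> rsum V R z (\<lambda>j. entry V R q 1 b 0 j \<odot> entry V R ?N q (r i) j l) q) p)"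
    if a: "a \<in> hom V z (mat_obj V R p 1)" and b: "b \<in> hom V z (mat_obj V R q 1)"
      and r: "\<And>i. r i \<in> hom V z (mat_obj V R ?N q)" for p q a b r
  proof -
    have br: "mmul ?N q 1 b (r i) \<in> hom V z (mat_obj V R ?N 1)" for i by (rule mmul_hom[OF b r])
    have t: "?tup p (\<lambda>i. mmul ?N q 1 b (r i)) \<in> hom V z (mat_obj V R ?N p)"
      by (rule thy_tuple_hom[OF z br])
    have "entry V R ?N 1 (mmul ?N p 1 a (?tup p (\<lambda>i. mmul ?N q 1 b (r i)))) 0 l
        = rsum V R z (\<lambda>i. entry V R p 1 a 0 i \<odot> rsum V R z (\<lambda>j. entry V R q 1 b 0 j \<odot> entry V R ?N q (r i) j l) q) p"
      if l: "l < ?N" for l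
      unfolding entry_mmul[OF a t zero_less_one l]
    proof (rule rsum_cong)
      fix i assume i: "i < p"
      show "entry V R p 1 a 0 i \<odot> entry V R ?N p (?tup p (\<lambda>i. mmul ?N q 1 b (r i))) i l
        = entry V R p 1 a 0 i \<odot> rsum V R z (\<lambda>j. entry V R q 1 b 0 j \<odot> entry V R ?N q (r i) j l) q"
        unfolding entry_thy_tuple[OF z br i l] entry_mmul[OF b r zero_less_one l] ..
    qed
    then show ?thesis using mmul_hom[OF a t] by blast
  qed
  have un: "mmul ?N n 1 u (?tup n (\<lambda>i. mmul ?N m 1 v (?tup m (e i))))
      = mmul ?N m 1 v (?tup m (\<lambda>j. mmul ?N n 1 u (?tup n (\<lambda>i. e i j))))" (is "?L = ?R")
  proof (rule mat_eqI)
    show "?L \<in> hom V z (mat_obj V R ?N 1)" "?R \<in> hom V z (mat_obj V R ?N 1)"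
      using composite[OF u v row] composite[OF v u col] by auto
    fix k l assume "k < (1::nat)" and l: "l < ?N"
    then have k: "k = 0" by simp
    let ?p = "l div m" and ?q = "l mod m"
    have m: "0 < m" using l by (cases m) auto
    have p: "?p < n" using l by (simp add: less_mult_imp_div_less)
    have q: "?q < m" using m by simp
    have idx: "i * m + j = l \<longleftrightarrow> i = ?p \<and> j = ?q" if "j < m" for i j
      using that by auto
    have eu: "entry V R n 1 u 0 i \<in> hom V z (Car R)" if "i < n" for i using u that by auto
    have ev: "entry V R m 1 v 0 j \<in> hom V z (Car R)" if "j < m" for j using v that by auto
    have erow: "entry V R ?N m (?tup m (e i)) j l = kron z (i * m + j) l" if "j < m" for i j
      using entry_thy_tuple[OF z e that l] ee[OF l] by simp
    have ecol: "entry V R ?N n (?tup n (\<lambda>i. e i j)) i l = kron z (i * m + j) l" if "i < n" for i j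
      using entry_thy_tuple[OF z e that l] ee[OF l] by simp
    have "entry V R ?N 1 ?L 0 l = rsum V R z (\<lambda>i. entry V R n 1 u 0 i \<odot>
        rsum V R z (\<lambda>j. entry V R m 1 v 0 j \<odot> kron z (i * m + j) l) m) n"
      using composite[OF u v row] l by (simp add: erow cong: rsum_cong)
    also have "\<dots> = entry V R n 1 u 0 ?p \<odot> entry V R m 1 v 0 ?q"
      by (rule rsum_rsum_kron[OF z eu ev p q idx])
    also have "\<dots> = entry V R m 1 v 0 ?q \<odot> entry V R n 1 u 0 ?p"
      using comm z eu[OF p] ev[OF q] unfolding is_commutative_rig_def by blast
    also have "\<dots> = rsum V R z (\<lambda>j. entry V R m 1 v 0 j \<odot>
        rsum V R z (\<lambda>i. entry V R n 1 u 0 i \<odot> kron z (i * m + j) l) n) m"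
      by (rule rsum_rsum_kron[OF z ev eu q p, symmetric]) (use idx in auto)
    also have "\<dots> = entry V R ?N 1 ?R 0 l"
      using composite[OF v u col] l by (simp add: ecol cong: rsum_cong)
    finally show "entry V R ?N 1 ?L k l = entry V R ?N 1 ?R k l" unfolding k .
  qed
  then show "mmul ?N n 1 (Fst V (mat_obj V R n 1) (mat_obj V R m 1))
     (thy_tuple V (Mat V R) (mat_obj V R n 1 \<otimes> mat_obj V R m 1) ?N n
       (\<lambda>i. mmul ?N m 1 (Snd V (mat_obj V R n 1) (mat_obj V R m 1))
          (thy_tuple V (Mat V R) (mat_obj V R n 1 \<otimes> mat_obj V R m 1) ?N m
            (\<lambda>j. const V (mat_obj V R n 1 \<otimes> mat_obj V R m 1) (Proj (Mat V R) ?N (i * m + j)))))) =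
    mmul ?N m 1 (Snd V (mat_obj V R n 1) (mat_obj V R m 1))
     (thy_tuple V (Mat V R) (mat_obj V R n 1 \<otimes> mat_obj V R m 1) ?N m
       (\<lambda>j. mmul ?N n 1 (Fst V (mat_obj V R n 1) (mat_obj V R m 1))
          (thy_tuple V (Mat V R) (mat_obj V R n 1 \<otimes> mat_obj V R m 1) ?N n
            (\<lambda>i. const V (mat_obj V R n 1 \<otimes> mat_obj V R m 1) (Proj (Mat V R) ?N (i * m + j))))))"
    unfolding z_def u_def v_def e_def .
qed

end

section \<open>Saturation and balance\<close>

theorem corollary7p3:
  fixes V :: "('o, 'm) ccc" and R :: "('o, 'm) rig"
  assumes "cartesian_closed V"
    and "has_equalizers V"
    and "has_countable_colimits V"
    and "has_countable_strong_intersections V"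
    and "is_rig V R"
  shows "is_saturated V (Car R) (Mat V R) (mat_act V R) \<and>
    is_subtheory V (Mat V R) (full_theory V (Car R)) (mat_act V R) \<and>
    (is_commutative_rig V R \<longrightarrow>
       is_balanced V (Car R) (Mat V R) (mat_act V R) \<and>
       is_commutative_theory V (Mat V R))"
proof -
  interpret rig_elements V R
    by (intro rig_elements.intro ccc_elements.intro rig_elements_axioms.intro assms)
  interpret op: rig_elements V "op_rig V R" by (rule op_rig_elements)
  have refl: "iso_over V (Car R) (Mat V R) (mat_act V R) (Mat V R) (mat_act V R)"
    by (rule iso_over_refl[OF mat_act_over])
  have "is_commutant V (Car R) (Mat V (op_rig V R)) (mat_act V (op_rig V R)) (Mat V R) (mat_act V R)"
    using op.Mat_commutant by (simp add: op_op_rig)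
  then have "is_saturated V (Car R) (Mat V R) (mat_act V R)"
    unfolding is_saturated_def using Mat_commutant refl by blast
  moreover have "is_balanced V (Car R) (Mat V R) (mat_act V R)" if "is_commutative_rig V R"
    unfolding is_balanced_def using Mat_commutant refl by (auto simp: op_commutative_rig[OF that])
  ultimately show ?thesis using mat_act_subtheory Mat_is_commutative_theory by blast
qed

end
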